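(* Let $\mathcal{A},\mathcal{B}\in\mathbb{C}^{n\times n\times n_3}$ both be normal, let $\lambda_1,\dots,\lambda_{nn_3}$ be the t-eigenvalues of $\mathcal{A}$ and let $\mu_1,\dots,\mu_{nn_3}$ be the t-eigenvalues of $\mathcal{B}$. Then there is a permutation $\pi$ of the integers $1,\dots,nn_3$ such that $$\left(\sum_{i=1}^{nn_3}|\mu_{\pi(i)}-\lambda_i|^2\right)^{1/2}\le n_3\|\mathcal{B}-\mathcal{A}\|_F.$$
   Context: For a real or complex $n_1\times n_2\times n_3$ tensor $\mathcal{A}$ with frontal slices $A^{(1)},\dots,A^{(n_3)}$ (each $n_1\times n_2$), $\mathrm{bcirc}(\mathcal{A})$ is the $n_1n_3\times n_2n_3$ block circulant matrix whose first block column is $A^{(1)},A^{(2)},\dots,A^{(n_3)}$ (top to bottom), i.e. its $(i,j)$ block is $A^{(((i-j)\bmod n_3)+1)}$. $\mathrm{unfold}(\mathcal{A})$ is the first block column of $\mathrm{bcirc}(\mathcal{A})$ and $\mathrm{fold}$ is its inverse. The t-product is $\mathcal{A}*\mathcal{B}=\mathrm{fold}(\mathrm{bcirc}(\mathcal{A})\cdot\mathrm{unfold}(\mathcal{B}))$. The conjugate transpose $\mathcal{A}^{H}$ is obtained by conjugate-transposing each frontal slice and reversing the order of the resulting slices $2,\dots,n_3$ (for real tensors this is the transpose $\mathcal{A}^T$). A tensor $\mathcal{A}\in\mathbb{C}^{n\times n\times n_3}$ is normal if $\mathcal{A}^{H}*\mathcal{A}=\mathcal{A}*\mathcal{A}^{H}$.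 A scalar $\lambda\in\mathbb{C}$ is a t-eigenvalue of an $n\times n\times n_3$ tensor $\mathcal{A}$ if $\mathcal{A}*\mathcal{X}=\lambda\mathcal{X}$ for some nonzero $\mathcal{X}\in\mathbb{C}^{n\times1\times n_3}$; equivalently, the t-eigenvalues are the $nn_3$ eigenvalues of $\mathrm{bcirc}(\mathcal{A})$, and they are counted with algebraic multiplicity as such. The Frobenius norm is $\|\mathcal{A}\|_F=\sqrt{\sum_{i,j,k}|a_{ijk}|^2}$. *)

theory Defs
  imports
    "Jordan_Normal_Form.Char_Poly"
    "Jordan_Normal_Form.Schur_Decomposition"
    "HOL-Combinatorics.Permutations"
begin

text \<open>A third-order tensor of size n1 x n2 x n3 is the list of its n3 frontal slices, each of them
  an n1 x n2 matrix. Slices, blocks and matrix entries are numbered from 0, so that \<open>A ! k\<close> is the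
  slice usually written with superscript k + 1.\<close>

type_synonym 'a tensor = "'a mat list"

definition carrier_tensor :: "nat \<Rightarrow> nat \<Rightarrow> nat \<Rightarrow> 'a tensor set" where
  "carrier_tensor n1 n2 n3 = {A. length A = n3 \<and> (\<forall>M \<in> set A. M \<in> carrier_mat n1 n2)}"

text \<open>The sizes n1 and n2 are read off from the first slice, so these operations are meaningful for
  tensors with at least one slice.\<close>

definition bcirc :: "'a tensor \<Rightarrow> 'a mat" where
  "bcirc A = (let n1 = dim_row (hd A); n2 = dim_col (hd A); n3 = length A in
     mat (n1 * n3) (n2 * n3) (\<lambda>(i, j).
       (A ! nat ((int (i div n1) - int (j div n2)) mod int n3)) $$ (i mod n1, j mod n2)))"

definition t_unfold :: "'a tensor \<Rightarrow> 'a mat" where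
  "t_unfold A = (let n1 = dim_row (hd A); n2 = dim_col (hd A); n3 = length A in
     mat (n1 * n3) n2 (\<lambda>(i, j). (A ! (i div n1)) $$ (i mod n1, j)))"

text \<open>Cuts a matrix into \<open>n3\<close> consecutive row blocks of equal height.\<close>

definition t_fold :: "nat \<Rightarrow> 'a mat \<Rightarrow> 'a tensor" where
  "t_fold n3 M = (let n1 = dim_row M div n3 in
     map (\<lambda>k. mat n1 (dim_col M) (\<lambda>(i, j). M $$ (k * n1 + i, j))) [0..<n3])"

definition t_prod :: "'a :: semiring_0 tensor \<Rightarrow> 'a tensor \<Rightarrow> 'a tensor" (infixl "*\<^sub>t" 70) where
  "A *\<^sub>t B = t_fold (length A) (bcirc A * t_unfold B)"

definition t_minus :: "'a :: minus tensor \<Rightarrow> 'a tensor \<Rightarrow> 'a tensor" (infixl "-\<^sub>t" 65) where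
  "A -\<^sub>t B = map2 (-) A B"

definition t_smult :: "'a :: times \<Rightarrow> 'a tensor \<Rightarrow> 'a tensor" (infixl "\<cdot>\<^sub>t" 70) where
  "c \<cdot>\<^sub>t A = map (\<lambda>M. c \<cdot>\<^sub>m M) A"

definition t_zero :: "nat \<Rightarrow> nat \<Rightarrow> nat \<Rightarrow> 'a :: zero tensor" where
  "t_zero n1 n2 n3 = replicate n3 (0\<^sub>m n1 n2)"

fun t_adjoint :: "complex tensor \<Rightarrow> complex tensor" where
  "t_adjoint [] = []"
| "t_adjoint (S # Ss) = mat_adjoint S # rev (map mat_adjoint Ss)"

definition t_normal :: "complex tensor \<Rightarrow> bool" where
  "t_normal A \<longleftrightarrow> t_adjoint A *\<^sub>t A = A *\<^sub>t t_adjoint A"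

definition t_frob_norm :: "complex tensor \<Rightarrow> real" where
  "t_frob_norm A =
     sqrt (\<Sum>k<length A. \<Sum>i<dim_row (A ! k). \<Sum>j<dim_col (A ! k). (cmod ((A ! k) $$ (i, j)))\<^sup>2)"

definition t_eigenvalue :: "complex tensor \<Rightarrow> complex \<Rightarrow> bool" where
  "t_eigenvalue A z \<longleftrightarrow> (let n = dim_row (hd A); n3 = length A in
     \<exists>X \<in> carrier_tensor n 1 n3. X \<noteq> t_zero n 1 n3 \<and> A *\<^sub>t X = z \<cdot>\<^sub>t X)"

definition t_multiplicity :: "complex tensor \<Rightarrow> complex \<Rightarrow> nat" where
  "t_multiplicity A z = Polynomial.order z (char_poly (bcirc A))"

text \<open>\<open>lam 1, \<dots>, lam N\<close> are the t-eigenvalues of \<open>A\<close>, each of them repeated according to its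
  algebraic multiplicity.\<close>

definition lists_t_eigenvalues :: "complex tensor \<Rightarrow> nat \<Rightarrow> (nat \<Rightarrow> complex) \<Rightarrow> bool" where
  "lists_t_eigenvalues A N lam \<longleftrightarrow>
     lam ` {1..N} = {z. t_eigenvalue A z} \<and>
     (\<forall>z. t_eigenvalue A z \<longrightarrow> card {i \<in> {1..N}. lam i = z} = t_multiplicity A z)"

lemma carrier_tensorD:
  assumes "A \<in> carrier_tensor n1 n2 n3"
  shows "length A = n3" "k < n3 \<Longrightarrow> A ! k \<in> carrier_mat n1 n2"
    "k < n3 \<Longrightarrow> dim_row (A ! k) = n1" "k < n3 \<Longrightarrow> dim_col (A ! k) = n2"
    "0 < n3 \<Longrightarrow> dim_row (hd A) = n1" "0 < n3 \<Longrightarrow> dim_col (hd A) = n2"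
proof -
  show l: "length A = n3" using assms by (auto simp: carrier_tensor_def)
  show c: "A ! k \<in> carrier_mat n1 n2" if "k < n3" for k
    using assms that by (auto simp: carrier_tensor_def)
  show "k < n3 \<Longrightarrow> dim_row (A ! k) = n1" "k < n3 \<Longrightarrow> dim_col (A ! k) = n2"
    using c[of k] by auto
  assume "0 < n3"
  then have "hd A = A ! 0" using l by (cases A) auto
  then show "dim_row (hd A) = n1" "dim_col (hd A) = n2" using c[OF \<open>0 < n3\<close>] by auto
qed

lemma t_fold_carrier:
  assumes "M \<in> carrier_mat (n1 * n3) n2" "0 < n3"
  shows "t_fold n3 M \<in> carrier_tensor n1 n2 n3"
  using assms by (auto simp: t_fold_def carrier_tensor_def Let_def)

lemma t_unfold_carrier:
  assumes "A \<in> carrier_tensor n1 n2 n3" "0 < n3"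
  shows "t_unfold A \<in> carrier_mat (n1 * n3) n2"
  using assms carrier_tensorD[OF assms(1)] by (auto simp: t_unfold_def Let_def)

lemma bcirc_carrier:
  assumes "A \<in> carrier_tensor n1 n2 n3" "0 < n3"
  shows "bcirc A \<in> carrier_mat (n1 * n3) (n2 * n3)"
  using assms carrier_tensorD[OF assms(1)] by (auto simp: bcirc_def Let_def)

lemma block_index_less: "k < n3 \<Longrightarrow> i < n1 \<Longrightarrow> k * n1 + i < n1 * (n3::nat)"
proof -
  assume k: "k < n3" and i: "i < n1"
  have "k * n1 + i < Suc k * n1" using i by simp
  also have "\<dots> \<le> n3 * n1" using k by (intro mult_right_mono) auto
  finally show ?thesis by (simp add: mult.commute)
qed

lemma t_fold_unfold:
  assumes A: "A \<in> carrier_tensor n1 n2 n3" and "0 < n3"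
  shows "t_fold n3 (t_unfold A) = A"
proof (rule nth_equalityI)
  show "length (t_fold n3 (t_unfold A)) = length A"
    using carrier_tensorD(1)[OF A] by (simp add: t_fold_def Let_def)
  fix k assume "k < length (t_fold n3 (t_unfold A))"
  then have k: "k < n3" by (simp add: t_fold_def Let_def)
  note D = carrier_tensorD[OF A]
  show "t_fold n3 (t_unfold A) ! k = A ! k"
    using k D \<open>0 < n3\<close>
    by (intro eq_matI) (auto simp: t_fold_def t_unfold_def Let_def block_index_less)
qed

lemma t_unfold_fold:
  assumes M: "M \<in> carrier_mat (n1 * n3) n2" and "0 < n3"
  shows "t_unfold (t_fold n3 M) = M"
proof -
  note D = carrier_tensorD[OF t_fold_carrier[OF assms]]
  show ?thesis
  proof (rule eq_matI)
    fix i j assume i: "i < dim_row M" and j: "j < dim_col M"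
    have "i < n1 * n3" using i M by auto
    moreover have "i div n1 < n3" using i M by (auto simp: less_mult_imp_div_less mult.commute)
    moreover have "0 < n1" using i M by (cases n1) auto
    ultimately show "t_unfold (t_fold n3 M) $$ (i, j) = M $$ (i, j)"
      using D M j \<open>0 < n3\<close> by (auto simp: t_unfold_def Let_def t_fold_def)
  qed (use D M \<open>0 < n3\<close> in \<open>auto simp: t_unfold_def Let_def\<close>)
qed

lemma t_unfold_zero:
  "0 < n3 \<Longrightarrow> t_unfold (t_zero n1 n2 n3) = (0\<^sub>m (n1 * n3) n2 :: 'a :: zero mat)"
proof -
  assume n3: "0 < n3"
  have h: "hd (replicate n3 x) = x" for x :: "'a mat" using n3 by (cases n3) auto
  show ?thesis
    by (rule eq_matI)
      (auto simp: t_unfold_def t_zero_def Let_def h less_mult_imp_div_less mult.commute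
         intro!: index_zero_mat mod_less_divisor gr0I)
qed

lemma t_unfold_smult:
  assumes X: "X \<in> carrier_tensor n1 n2 n3" and "0 < n3"
  shows "t_unfold (c \<cdot>\<^sub>t X) = c \<cdot>\<^sub>m t_unfold X"
proof -
  note D = carrier_tensorD[OF X]
  have "hd (c \<cdot>\<^sub>t X) = c \<cdot>\<^sub>m hd X" using D(1) \<open>0 < n3\<close> by (cases X) (auto simp: t_smult_def)
  then show ?thesis using D \<open>0 < n3\<close>
    apply (intro eq_matI)
      apply (auto simp: t_unfold_def Let_def t_smult_def less_mult_imp_div_less mult.commute)
    by (subst index_smult_mat)
      (auto simp: less_mult_imp_div_less mult.commute intro!: mod_less_divisor gr0I)
qed

lemma t_eigenvalue_iff_eigenvalue_bcirc:
  assumes A: "A \<in> carrier_tensor n n n3" and n3: "0 < n3"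
  shows "t_eigenvalue A z \<longleftrightarrow> eigenvalue (bcirc A) z"
proof
  note D = carrier_tensorD[OF A]
  note bc = bcirc_carrier[OF A n3]
  {
    assume "t_eigenvalue A z"
    then obtain X where X: "X \<in> carrier_tensor n 1 n3" "X \<noteq> t_zero n 1 n3" "A *\<^sub>t X = z \<cdot>\<^sub>t X"
      using D n3 by (auto simp: t_eigenvalue_def Let_def)
    let ?M = "t_unfold X"
    have M: "?M \<in> carrier_mat (n * n3) 1" by (rule t_unfold_carrier[OF X(1) n3])
    have "bcirc A * ?M \<in> carrier_mat (n * n3) 1" using bc M by auto
    then have "bcirc A * ?M = t_unfold (A *\<^sub>t X)"
      by (simp add: t_prod_def D(1) t_unfold_fold n3)
    then have e: "bcirc A * ?M = z \<cdot>\<^sub>m ?M" by (simp add: X(3) t_unfold_smult[OF X(1) n3])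
    have "?M \<noteq> 0\<^sub>m (n * n3) 1"
    proof
      assume "?M = 0\<^sub>m (n * n3) 1"
      then have "t_fold n3 ?M = t_fold n3 (t_unfold (t_zero n 1 n3))" by (simp add: t_unfold_zero n3)
      moreover have "t_zero n 1 n3 \<in> carrier_tensor n 1 n3"
        by (auto simp: t_zero_def carrier_tensor_def)
      ultimately show False using X(1,2) n3 by (metis t_fold_unfold)
    qed
    then have nz: "col ?M 0 \<noteq> 0\<^sub>v (n * n3)"
      using M by (metis (no_types, lifting) One_nat_def carrier_matD eq_matI index_col index_zero_mat
          index_zero_vec(1) less_Suc0)
    have "bcirc A *\<^sub>v col ?M 0 = col (bcirc A * ?M) 0" using bc M by (subst col_mult2) auto
    also have "\<dots> = z \<cdot>\<^sub>v col ?M 0" unfolding e using M by auto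
    finally have "bcirc A *\<^sub>v col ?M 0 = z \<cdot>\<^sub>v col ?M 0" .
    moreover have "dim_row (bcirc A) = n * n3" using bc by auto
    moreover have "col ?M 0 \<in> carrier_vec (n * n3)" using M by (metis carrier_matD(1) col_dim)
    ultimately show "eigenvalue (bcirc A) z"
      using nz unfolding eigenvalue_def eigenvector_def by metis
  }
  {
    assume "eigenvalue (bcirc A) z"
    then obtain v where v: "v \<in> carrier_vec (n * n3)" "v \<noteq> 0\<^sub>v (n * n3)" "bcirc A *\<^sub>v v = z \<cdot>\<^sub>v v"
      using bc by (auto simp: eigenvalue_def eigenvector_def)
    let ?M = "mat_of_cols (n * n3) [v]"
    have M: "?M \<in> carrier_mat (n * n3) 1" by (auto simp: mat_of_cols_def)
    let ?X = "t_fold n3 ?M"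
    have X: "?X \<in> carrier_tensor n 1 n3" by (rule t_fold_carrier[OF M n3])
    have cM: "col ?M 0 = v" using v(1) by (auto simp: mat_of_cols_def)
    have e: "bcirc A * ?M = z \<cdot>\<^sub>m ?M"
    proof (rule mat_col_eqI)
      fix i assume "i < dim_col (z \<cdot>\<^sub>m ?M)"
      then have i: "i = 0" by (simp add: mat_of_cols_def)
      show "col (bcirc A * ?M) i = col (z \<cdot>\<^sub>m ?M) i"
        unfolding i using bc M v cM by (subst col_mult2[OF bc M]) auto
    qed (use bc M in auto)
    have "A *\<^sub>t ?X = t_fold n3 (t_unfold (z \<cdot>\<^sub>t ?X))"
      by (simp only: t_prod_def D(1) t_unfold_smult[OF X n3] t_unfold_fold[OF M n3] e)
    also have "\<dots> = z \<cdot>\<^sub>t ?X"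
      by (rule t_fold_unfold[OF _ n3, of _ n 1]) (use X in \<open>auto simp: t_smult_def carrier_tensor_def\<close>)
    finally have ev: "A *\<^sub>t ?X = z \<cdot>\<^sub>t ?X" .
    have "?X \<noteq> t_zero n 1 n3"
    proof
      assume "?X = t_zero n 1 n3"
      then have "?M = 0\<^sub>m (n * n3) 1" using t_unfold_fold[OF M n3] t_unfold_zero[OF n3, of n 1] by metis
      then have "col ?M 0 = col (0\<^sub>m (n * n3) 1) 0" by simp
      then show False using cM v(2) by simp
    qed
    then show "t_eigenvalue A z" using X ev D n3 by (auto simp: t_eigenvalue_def Let_def)
  }
qed

lemma lists_t_eigenvalues_exists:
  assumes A: "A \<in> carrier_tensor n n n3" and n3: "0 < n3"
  shows "\<exists>lam. lists_t_eigenvalues A (n * n3) lam"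
proof -
  note bc = bcirc_carrier[OF A n3]
  obtain es where es: "char_poly (bcirc A) = (\<Prod>e\<leftarrow>es. [:- e, 1:])" "length es = n * n3"
    using char_poly_factorized[OF bc] by auto
  have ord: "Polynomial.order z (\<Prod>e\<leftarrow>es. [:- e, 1:]) = card {i. i < length es \<and> es ! i = z}" for z
  proof -
    have "Polynomial.order z (\<Prod>e\<leftarrow>es. [:- e, 1:]) = count_list es z"
    proof (induction es)
      case (Cons e es)
      have "(\<Prod>e\<leftarrow>es. [:- e, 1:]) \<noteq> 0" by (auto simp: prod_list_zero_iff)
      then have "[:- e, 1:] * (\<Prod>e\<leftarrow>es. [:- e, 1:]) \<noteq> 0" by (simp del: mult_pCons_left)
      then have "Polynomial.order z ([:- e, 1:] * (\<Prod>e\<leftarrow>es. [:- e, 1:])) =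
          Polynomial.order z [:- e, 1:] + Polynomial.order z (\<Prod>e\<leftarrow>es. [:- e, 1:])"
        by (rule Polynomial.order_mult)
      moreover have "Polynomial.order z [:- e, 1:] = (if e = z then 1 else 0)"
        by (auto simp: order_linear')
      ultimately show ?case using Cons by (simp del: mult_pCons_left)
    qed (simp add: order_1_eq_0)
    also have "\<dots> = card {i. i < length es \<and> z = es ! i}"
      by (simp only: count_list_eq_length_filter length_filter_conv_card)
    also have "{i. i < length es \<and> z = es ! i} = {i. i < length es \<and> es ! i = z}" by auto
    finally show ?thesis .
  qed
  define lam where "lam i = es ! (i - 1)" for i :: nat
  have ev: "t_eigenvalue A z \<longleftrightarrow> z \<in> set es" for z
    unfolding t_eigenvalue_iff_eigenvalue_bcirc[OF A n3] eigenvalue_root_char_poly[OF bc] es(1)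
    by (auto simp: poly_prod_list prod_list_zero_iff)
  have img: "{1..n * n3} = Suc ` {..<n * n3}" by (simp add: image_Suc_lessThan)
  have "lam ` {1..n * n3} = set es"
    unfolding img by (auto simp: lam_def image_image set_conv_nth es(2))
  moreover have "card {i \<in> {1..n * n3}. lam i = z} = t_multiplicity A z" for z
  proof -
    have "{i \<in> {1..n * n3}. lam i = z} = Suc ` {i. i < length es \<and> es ! i = z}"
      unfolding img by (auto simp: lam_def es(2))
    then show ?thesis by (simp add: card_image t_multiplicity_def es(1) ord)
  qed
  ultimately show ?thesis using ev by (intro exI[of _ lam]) (auto simp: lists_t_eigenvalues_def)
qed

end

theory Submission
  imports Defs
begin

text \<open>
  The t-eigenvalues of a tensor are the eigenvalues of its block circulant matrix, so the bound is
  the Hoffman--Wielandt inequality for the matrices \<open>bcirc A\<close> and \<open>bcirc B\<close>. Two facts about block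
  circulant matrices make this reduction work. They are invariant under simultaneous cyclic shifts
  of block rows and block columns, so such a matrix is determined by its first block column; since
  the t-product computes exactly the first block column of a product, the equation that makes a
  tensor normal makes its block circulant matrix normal (\<open>normal_mat_bcirc\<close>). By the same symmetry
  all block columns have the same norm, so the squared Frobenius norm of \<open>bcirc (B -\<^sub>t A)\<close> is
  \<open>n3\<close> times that of \<open>B -\<^sub>t A\<close>. This even gives the factor \<open>sqrt n3\<close>, which is at most \<open>n3\<close>.

  For the Hoffman--Wielandt inequality let \<open>A\<close> and \<open>B\<close> be normal matrices. Each is unitarily
  diagonalizable: an eigenvector can be split off by a unitary change of basis, and normality forces
  the rest of the first row to vanish together with the rest of the first column. With
  \<open>U\<^sup>* A U = diag d\<close>, \<open>V\<^sup>* B V = diag e\<close> and \<open>W = U\<^sup>* V\<close>, the entry \<open>(k, l)\<close> of \<open>U\<^sup>* (B - A) V\<close> is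
  \<open>(e l - d k) W k l\<close>, whence the squared Frobenius norm of \<open>B - A\<close> equals
  \<open>\<Sum>k l. |e l - d k|\<^sup>2 |W k l|\<^sup>2\<close>. The matrix \<open>|W k l|\<^sup>2\<close> is doubly stochastic, and a linear cost on
  doubly stochastic matrices is never below its least value on permutation matrices.

  This last fact is Birkhoff's theorem in its optimization form
  (\<open>doubly_stochastic_cost_ge_assignment\<close>). If every row has at least two nonzero entries, a
  dimension count gives a nonzero matrix that vanishes wherever the given one does and has zero row
  and column sums; moving along it in the direction that does not raise the cost, until an entry
  vanishes, shrinks the support. Otherwise some row has a single nonzero entry, necessarily equal
  to 1, and its row and column can be removed.
\<close>

section \<open>Linear costs on doubly stochastic matrices\<close>

text \<open>Gaussian elimination, one equation at a time: an equation with a nonzero coefficient at \<open>w\<close>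
  is solved for the unknown \<open>w\<close> and substituted into the others.\<close>

lemma homogeneous_system_nontrivial_solution:
  fixes a :: "'e \<Rightarrow> 'v \<Rightarrow> real"
  assumes "finite E" "finite V" "card E < card V"
  shows "\<exists>x. (\<exists>v\<in>V. x v \<noteq> 0) \<and> (\<forall>e\<in>E. (\<Sum>v\<in>V. a e v * x v) = 0)"
  using assms
proof (induction E arbitrary: V a rule: finite_induct)
  case empty
  then have "V \<noteq> {}" by auto
  then show ?case by (intro exI[of _ "\<lambda>_. 1"]) auto
next
  case (insert e E)
  show ?case
  proof (cases "\<forall>v\<in>V. a e v = 0")
    case True
    then show ?thesis using insert.IH[of V a] insert.hyps insert.prems by force
  next
    case False
    then obtain w where w: "w \<in> V" "a e w \<noteq> 0" by auto
    define V' where "V' = V - {w}"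
    have "card E < card V'"
      using insert.hyps insert.prems w by (simp add: V'_def)
    then obtain x where x: "\<exists>v\<in>V'. x v \<noteq> 0"
      "\<And>f. f \<in> E \<Longrightarrow> (\<Sum>v\<in>V'. (a f v - a f w * a e v / a e w) * x v) = 0"
      using insert.IH[of V' "\<lambda>f v. a f v - a f w * a e v / a e w"] insert.prems V'_def by auto
    define s where "s = (\<Sum>v\<in>V'. a e v * x v)"
    define y where "y = x(w := - s / a e w)"
    have split: "(\<Sum>v\<in>V. a f v * y v) = a f w * (- s / a e w) + (\<Sum>v\<in>V'. a f v * x v)" for f
      using insert.prems w by (auto simp: sum.remove[of V w] y_def V'_def intro!: sum.cong)
    have "(\<Sum>v\<in>V. a f v * y v) = 0" if "f \<in> E" for f
    proof -
      have "(\<Sum>v\<in>V'. (a f v - a f w * a e v / a e w) * x v) =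
          (\<Sum>v\<in>V'. a f v * x v) - a f w / a e w * s"
        by (simp add: s_def algebra_simps sum_subtractf sum_distrib_left)
      then show ?thesis using x(2)[OF that] split[of f] by simp
    qed
    moreover have "(\<Sum>v\<in>V. a e v * y v) = 0"
      using split[of e] w by (simp add: s_def)
    moreover have "\<exists>v\<in>V. y v \<noteq> 0" using x(1) by (auto simp: y_def V'_def)
    ultimately show ?thesis by (intro exI[of _ y]) auto
  qed
qed

definition doubly_stochastic :: "'a set \<Rightarrow> 'b set \<Rightarrow> ('a \<Rightarrow> 'b \<Rightarrow> real) \<Rightarrow> bool" where
  "doubly_stochastic I J D \<longleftrightarrow> (\<forall>i\<in>I. \<forall>j\<in>J. 0 \<le> D i j) \<and>
     (\<forall>i\<in>I. (\<Sum>j\<in>J. D i j) = 1) \<and> (\<forall>j\<in>J. (\<Sum>i\<in>I. D i j) = 1)"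

text \<open>A dimension count. The support offers at least \<open>2 |I|\<close> unknowns, while only \<open>2 |I| - 1\<close>
  equations have to be imposed: the sum of one column vanishes automatically once all row sums and
  all other column sums do.\<close>

lemma zero_line_sums_perturbation:
  assumes fin: "finite I" "finite J" and ne: "I \<noteq> {}" and card: "card I = card J"
    and S: "S \<subseteq> I \<times> J" and two: "\<And>i. i \<in> I \<Longrightarrow> 2 \<le> card {j \<in> J. (i, j) \<in> S}"
  shows "\<exists>E :: 'a \<Rightarrow> 'b \<Rightarrow> real. (\<exists>i\<in>I. \<exists>j\<in>J. E i j \<noteq> 0) \<and>
    (\<forall>i\<in>I. \<forall>j\<in>J. (i, j) \<notin> S \<longrightarrow> E i j = 0) \<and>
    (\<forall>i\<in>I. (\<Sum>j\<in>J. E i j) = 0) \<and> (\<forall>j\<in>J. (\<Sum>i\<in>I. E i j) = 0)"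
proof -
  have finS: "finite S" using S fin by (meson finite_SigmaI finite_subset)
  have "J \<noteq> {}" using fin ne card by auto
  then obtain j0 where j0: "j0 \<in> J" by blast
  define eqs :: "('a + 'b) set" where "eqs = Inl ` I \<union> Inr ` (J - {j0})"
  define a :: "'a + 'b \<Rightarrow> 'a \<times> 'b \<Rightarrow> real" where
    "a e v = (case e of Inl i \<Rightarrow> of_bool (fst v = i) | Inr j \<Rightarrow> of_bool (snd v = j))" for e v
  have "card eqs = card I + (card J - 1)"
    using fin j0 unfolding eqs_def
    by (subst card_Un_disjoint) (auto simp: card_image)
  moreover have "card I > 0" using fin ne by (simp add: card_gt_0_iff)
  ultimately have lt: "card eqs < 2 * card I" using card by simp
  also have "\<dots> \<le> (\<Sum>i\<in>I. card {j \<in> J. (i, j) \<in> S})"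
    using sum_mono[of I "\<lambda>_. 2" "\<lambda>i. card {j \<in> J. (i, j) \<in> S}"] two by simp
  also have "\<dots> = card (SIGMA i:I. {j \<in> J. (i, j) \<in> S})" using fin by simp
  also have "(SIGMA i:I. {j \<in> J. (i, j) \<in> S}) = S" using S by auto
  finally have "card eqs < card S" .
  moreover have "finite eqs" using fin by (simp add: eqs_def)
  ultimately obtain x where x: "\<exists>v\<in>S. x v \<noteq> 0" "\<And>e. e \<in> eqs \<Longrightarrow> (\<Sum>v\<in>S. a e v * x v) = 0"
    using homogeneous_system_nontrivial_solution[of eqs S a] finS by blast
  define E where "E i j = (if (i, j) \<in> S then x (i, j) else 0)" for i j
  \<comment> \<open>Sums over the support are sums over all positions, which turns each equation into a line sum.\<close>
  have tot: "(\<Sum>v\<in>S. f v * x v) = (\<Sum>i\<in>I. \<Sum>j\<in>J. f (i, j) * E i j)" for f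
  proof -
    have "(\<Sum>i\<in>I. \<Sum>j\<in>J. f (i, j) * E i j) = (\<Sum>v\<in>I \<times> J. f v * E (fst v) (snd v))"
      by (simp add: sum.cartesian_product case_prod_beta)
    also have "\<dots> = (\<Sum>v\<in>S. f v * E (fst v) (snd v))"
      using S fin by (intro sum.mono_neutral_right) (auto simp: E_def)
    also have "\<dots> = (\<Sum>v\<in>S. f v * x v)" by (rule sum.cong) (auto simp: E_def)
    finally show ?thesis by simp
  qed
  have row: "(\<Sum>j\<in>J. E i j) = 0" if i: "i \<in> I" for i
  proof -
    have "0 = (\<Sum>i'\<in>I. \<Sum>j\<in>J. of_bool (i' = i) * E i' j)"
      using x(2)[of "Inl i"] tot[of "a (Inl i)"] i by (simp add: eqs_def a_def)
    also have "\<dots> = (\<Sum>i'\<in>I. of_bool (i' = i) * (\<Sum>j\<in>J. E i' j))" by (simp add: sum_distrib_left)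
    also have "\<dots> = (\<Sum>i'\<in>I. if i' = i then (\<Sum>j\<in>J. E i' j) else 0)"
      by (rule sum.cong) auto
    finally show ?thesis using i fin by (simp add: sum.delta)
  qed
  have col: "(\<Sum>i\<in>I. E i j) = 0" if j: "j \<in> J - {j0}" for j
  proof -
    have "0 = (\<Sum>i\<in>I. \<Sum>j'\<in>J. of_bool (j' = j) * E i j')"
      using x(2)[of "Inr j"] tot[of "a (Inr j)"] j by (simp add: eqs_def a_def)
    also have "\<dots> = (\<Sum>i\<in>I. \<Sum>j'\<in>J. if j' = j then E i j' else 0)"
      by (intro sum.cong) auto
    finally show ?thesis using j fin by (simp add: sum.delta)
  qed
  have "(\<Sum>j\<in>J. \<Sum>i\<in>I. E i j) = 0" using row by (subst sum.swap) simp
  then have "(\<Sum>i\<in>I. E i j0) = 0" using col j0 fin by (simp add: sum.remove[of J j0])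
  with col have "\<forall>j\<in>J. (\<Sum>i\<in>I. E i j) = 0" by blast
  moreover have "\<exists>i\<in>I. \<exists>j\<in>J. E i j \<noteq> 0" using x(1) S by (force simp: E_def)
  ultimately show ?thesis using row by (intro exI[of _ E]) (auto simp: E_def)
qed

text \<open>One step of the walk to a vertex of the polytope of doubly stochastic matrices: along a
  direction with zero line sums that keeps the zeros of \<open>D\<close>, go in the sense that does not increase
  the cost, until the first entry becomes zero.\<close>

lemma doubly_stochastic_smaller_support:
  fixes C D :: "'a \<Rightarrow> 'b \<Rightarrow> real"
  assumes fin: "finite I" "finite J" and ne: "I \<noteq> {}" and card: "card I = card J"
    and D: "doubly_stochastic I J D"
    and two: "\<And>i. i \<in> I \<Longrightarrow> 2 \<le> card {j \<in> J. D i j \<noteq> 0}"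
  shows "\<exists>D'. doubly_stochastic I J D' \<and>
    {(i, j) \<in> I \<times> J. D' i j \<noteq> 0} \<subset> {(i, j) \<in> I \<times> J. D i j \<noteq> 0} \<and>
    (\<Sum>i\<in>I. \<Sum>j\<in>J. C i j * D' i j) \<le> (\<Sum>i\<in>I. \<Sum>j\<in>J. C i j * D i j)"
proof -
  define S where "S = {(i, j) \<in> I \<times> J. D i j \<noteq> 0}"
  have S: "S \<subseteq> I \<times> J" by (auto simp: S_def)
  have "{j \<in> J. (i, j) \<in> S} = {j \<in> J. D i j \<noteq> 0}" if "i \<in> I" for i using that by (auto simp: S_def)
  then have "2 \<le> card {j \<in> J. (i, j) \<in> S}" if "i \<in> I" for i using two that by metis
  from zero_line_sums_perturbation[OF fin ne card S this]
  obtain E0 :: "'a \<Rightarrow> 'b \<Rightarrow> real" where E0: "\<exists>i\<in>I. \<exists>j\<in>J. E0 i j \<noteq> 0"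
    "\<forall>i\<in>I. \<forall>j\<in>J. (i, j) \<notin> S \<longrightarrow> E0 i j = 0"
    "\<forall>i\<in>I. (\<Sum>j\<in>J. E0 i j) = 0" "\<forall>j\<in>J. (\<Sum>i\<in>I. E0 i j) = 0"
    by blast
  define sg :: real where "sg = (if (\<Sum>i\<in>I. \<Sum>j\<in>J. C i j * E0 i j) \<le> 0 then 1 else - 1)"
  define E where "E i j = sg * E0 i j" for i j
  have sg0: "sg \<noteq> 0" by (simp add: sg_def)
  have E_ne: "\<exists>i\<in>I. \<exists>j\<in>J. E i j \<noteq> 0" using E0(1) sg0 by (auto simp: E_def)
  have E_supp: "E i j = 0" if "i \<in> I" "j \<in> J" "D i j = 0" for i j
    using E0(2) that by (auto simp: E_def S_def)
  have E_row: "(\<Sum>j\<in>J. E i j) = 0" if "i \<in> I" for i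
    using E0(3) that by (simp add: E_def flip: sum_distrib_left)
  have E_col: "(\<Sum>i\<in>I. E i j) = 0" if "j \<in> J" for j
    using E0(4) that by (simp add: E_def flip: sum_distrib_left)
  have "(\<Sum>i\<in>I. \<Sum>j\<in>J. C i j * E i j) = sg * (\<Sum>i\<in>I. \<Sum>j\<in>J. C i j * E0 i j)"
    by (simp add: E_def sum_distrib_left mult.left_commute)
  then have E_cost: "(\<Sum>i\<in>I. \<Sum>j\<in>J. C i j * E i j) \<le> 0" by (auto simp: sg_def)
  \<comment> \<open>A nonzero perturbation with zero row sums has negative entries; they limit the step length.\<close>
  define N where "N = {(i, j) \<in> I \<times> J. E i j < 0}"
  have finN: "finite N" using fin by (auto simp: N_def intro: finite_subset[of _ "I \<times> J"])
  have "N \<noteq> {}"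
  proof
    assume "N = {}"
    then have nn: "0 \<le> E i j" if "i \<in> I" "j \<in> J" for i j using that by (auto simp: N_def not_less)
    obtain i j where ij: "i \<in> I" "j \<in> J" "E i j \<noteq> 0" using E_ne by blast
    have "\<forall>j\<in>J. E i j = 0"
      using E_row[OF ij(1)] sum_nonneg_eq_0_iff[OF fin(2), of "E i"] nn ij(1) by simp
    then show False using ij by blast
  qed
  define q where "q v = D (fst v) (snd v) / - E (fst v) (snd v)" for v
  \<comment> \<open>The largest step that keeps all entries nonnegative.\<close>
  define t where "t = Min (q ` N)"
  have "t \<in> q ` N" unfolding t_def using finN \<open>N \<noteq> {}\<close> by (intro Min_in) auto
  then obtain i1 j1 where v1: "i1 \<in> I" "j1 \<in> J" "E i1 j1 < 0" "t = D i1 j1 / - E i1 j1"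
    by (auto simp: N_def q_def)
  have t_le: "t \<le> D i j / - E i j" if "i \<in> I" "j \<in> J" "E i j < 0" for i j
  proof -
    have "q (i, j) \<in> q ` N" using that by (intro imageI) (simp add: N_def)
    then show ?thesis unfolding t_def using finN by (simp add: q_def)
  qed
  have D0: "0 \<le> D i j" if "i \<in> I" "j \<in> J" for i j
    using D that by (auto simp: doubly_stochastic_def)
  have t0: "0 \<le> t" using v1 D0[of i1 j1] by (simp add: divide_nonneg_neg)
  define D' where "D' i j = D i j + t * E i j" for i j
  have D'_nn: "0 \<le> D' i j" if ij: "i \<in> I" "j \<in> J" for i j
  proof (cases "E i j < 0")
    case True
    then have "t * - E i j \<le> D i j" using t_le[OF ij True] pos_le_divide_eq[of "- E i j" t "D i j"] by linarith
    then show ?thesis by (simp add: D'_def)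
  next
    case False
    then show ?thesis using t0 D0[OF ij] by (simp add: D'_def)
  qed
  have "doubly_stochastic I J D'"
    using D D'_nn E_row E_col
    by (auto simp: doubly_stochastic_def D'_def sum.distrib simp flip: sum_distrib_left)
  moreover have "{(i, j) \<in> I \<times> J. D' i j \<noteq> 0} \<subset> {(i, j) \<in> I \<times> J. D i j \<noteq> 0}"
  proof
    show "{(i, j) \<in> I \<times> J. D' i j \<noteq> 0} \<subseteq> {(i, j) \<in> I \<times> J. D i j \<noteq> 0}"
      using E_supp by (auto simp: D'_def)
    have "D' i1 j1 = 0" using v1 by (simp add: D'_def)
    moreover have "D i1 j1 \<noteq> 0" using E_supp v1 by force
    ultimately show "{(i, j) \<in> I \<times> J. D' i j \<noteq> 0} \<noteq> {(i, j) \<in> I \<times> J. D i j \<noteq> 0}"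
      using v1 by blast
  qed
  moreover have "(\<Sum>i\<in>I. \<Sum>j\<in>J. C i j * D' i j) =
      (\<Sum>i\<in>I. \<Sum>j\<in>J. C i j * D i j) + t * (\<Sum>i\<in>I. \<Sum>j\<in>J. C i j * E i j)"
    by (simp add: D'_def algebra_simps sum.distrib sum_distrib_left)
  then have "(\<Sum>i\<in>I. \<Sum>j\<in>J. C i j * D' i j) \<le> (\<Sum>i\<in>I. \<Sum>j\<in>J. C i j * D i j)"
    using t0 E_cost by (simp add: mult_nonneg_nonpos)
  ultimately show ?thesis by blast
qed

lemma doubly_stochastic_remove:
  assumes fin: "finite I" "finite J" and D: "doubly_stochastic I J D"
    and i: "i \<in> I" and j: "j \<in> J" and Dij: "D i j = 1"
  shows "doubly_stochastic (I - {i}) (J - {j}) D"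
    and "\<And>j'. j' \<in> J - {j} \<Longrightarrow> D i j' = 0" and "\<And>i'. i' \<in> I - {i} \<Longrightarrow> D i' j = 0"
proof -
  have "(\<Sum>j'\<in>J - {j}. D i j') = 0"
    using D i j Dij fin by (auto simp: doubly_stochastic_def sum.remove[of J j])
  then show r: "D i j' = 0" if "j' \<in> J - {j}" for j'
    using that D fin i by (subst (asm) sum_nonneg_eq_0_iff) (auto simp: doubly_stochastic_def)
  have "(\<Sum>i'\<in>I - {i}. D i' j) = 0"
    using D i j Dij fin by (auto simp: doubly_stochastic_def sum.remove[of I i])
  then show c: "D i' j = 0" if "i' \<in> I - {i}" for i'
    using that D fin j by (subst (asm) sum_nonneg_eq_0_iff) (auto simp: doubly_stochastic_def)
  have "(\<Sum>j'\<in>J - {j}. D i' j') = (\<Sum>j'\<in>J. D i' j')" if "i' \<in> I - {i}" for i'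
    using fin j c[OF that] by (simp add: sum.remove[of J j])
  moreover have "(\<Sum>i'\<in>I - {i}. D i' j') = (\<Sum>i'\<in>I. D i' j')" if "j' \<in> J - {j}" for j'
    using fin i r[OF that] by (simp add: sum.remove[of I i])
  ultimately show "doubly_stochastic (I - {i}) (J - {j}) D"
    using D by (simp add: doubly_stochastic_def)
qed

text \<open>Birkhoff's theorem as a statement on minima: the induction decreases the size of the matrix
  or its support.\<close>

theorem doubly_stochastic_cost_ge_assignment:
  fixes C D :: "'a \<Rightarrow> 'b \<Rightarrow> real"
  assumes "finite I" "finite J" "card I = card J" "doubly_stochastic I J D"
  shows "\<exists>p. bij_betw p I J \<and> (\<Sum>i\<in>I. C i (p i)) \<le> (\<Sum>i\<in>I. \<Sum>j\<in>J. C i j * D i j)"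
  using assms
proof (induction "card I + card {(i, j) \<in> I \<times> J. D i j \<noteq> 0}" arbitrary: I J D rule: less_induct)
  case less
  note fin = less.prems(1,2) and D = less.prems(4)
  have finS: "finite {(i, j) \<in> I \<times> J. D' i j \<noteq> 0}" for D' :: "'a \<Rightarrow> 'b \<Rightarrow> real"
    using fin by (auto intro: finite_subset[of _ "I \<times> J"])
  consider "I = {}" | i j where "i \<in> I" "{j \<in> J. D i j \<noteq> 0} = {j}"
    | "I \<noteq> {}" "\<And>i. i \<in> I \<Longrightarrow> 2 \<le> card {j \<in> J. D i j \<noteq> 0}"
  proof -
    have "2 \<le> card {j \<in> J. D i j \<noteq> 0}"
      if "i \<in> I" "\<And>j. {j \<in> J. D i j \<noteq> 0} \<noteq> {j}" for i
    proof -
      have "{j \<in> J. D i j \<noteq> 0} \<noteq> {}"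
      proof
        assume "{j \<in> J. D i j \<noteq> 0} = {}"
        then have "(\<Sum>j\<in>J. D i j) = 0" by (intro sum.neutral) auto
        then show False using D that(1) by (auto simp: doubly_stochastic_def)
      qed
      then have "card {j \<in> J. D i j \<noteq> 0} \<noteq> 0" using fin by simp
      moreover have "card {j \<in> J. D i j \<noteq> 0} \<noteq> 1" using that(2) by (auto simp: card_1_singleton_iff)
      ultimately show ?thesis by linarith
    qed
    then show thesis using that by blast
  qed
  then show ?case
  proof cases
    case 1
    then have "J = {}" using less.prems by auto
    with 1 show ?thesis by (auto simp: bij_betw_def)
  next
    case (2 i j)
    then have j: "j \<in> J" by blast
    have "(\<Sum>j'\<in>J. D i j') = (\<Sum>j'\<in>{j}. D i j')"
      using 2 fin by (intro sum.mono_neutral_right) auto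
    then have Dij: "D i j = 1" using D 2(1) by (auto simp: doubly_stochastic_def)
    note rem = doubly_stochastic_remove[OF fin D 2(1) j Dij]
    have "card (I - {i}) < card I" using fin 2(1) by (intro card_Diff1_less)
    moreover have "card {(i', j') \<in> (I - {i}) \<times> (J - {j}). D i' j' \<noteq> 0} \<le>
        card {(i', j') \<in> I \<times> J. D i' j' \<noteq> 0}"
      by (intro card_mono finS) auto
    ultimately have "card (I - {i}) + card {(i', j') \<in> (I - {i}) \<times> (J - {j}). D i' j' \<noteq> 0} <
        card I + card {(i', j') \<in> I \<times> J. D i' j' \<noteq> 0}" by (rule add_less_le_mono)
    moreover have "card (I - {i}) = card (J - {j})" using less.prems(3) 2(1) j by simp
    ultimately obtain p where p: "bij_betw p (I - {i}) (J - {j})"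
      "(\<Sum>i'\<in>I - {i}. C i' (p i')) \<le> (\<Sum>i'\<in>I - {i}. \<Sum>j'\<in>J - {j}. C i' j' * D i' j')"
      using less.hyps[OF _ _ _ _ rem(1)] fin by blast
    define p' where "p' = p(i := j)"
    have "bij_betw p' (I - {i}) (J - {j})"
      using p(1) by (subst bij_betw_cong[of _ p' p]) (auto simp: p'_def)
    then have "bij_betw p' (insert i (I - {i})) (insert j (J - {j}))"
      using notIn_Un_bij_betw[of i "I - {i}" p' "J - {j}"] by (simp add: p'_def)
    then have "bij_betw p' I J" using 2(1) j by (simp add: insert_absorb)
    moreover have "(\<Sum>i'\<in>I. C i' (p' i')) = C i j + (\<Sum>i'\<in>I - {i}. C i' (p i'))"
      using fin 2(1) by (auto simp: sum.remove[of I i] p'_def intro!: sum.cong)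
    moreover have "(\<Sum>i'\<in>I. \<Sum>j'\<in>J. C i' j' * D i' j') =
        C i j + (\<Sum>i'\<in>I - {i}. \<Sum>j'\<in>J - {j}. C i' j' * D i' j')"
    proof -
      have "(\<Sum>j'\<in>J. C i j' * D i j') = C i j"
        using fin j rem(2) Dij by (simp add: sum.remove[of J j])
      moreover have "(\<Sum>j'\<in>J. C i' j' * D i' j') = (\<Sum>j'\<in>J - {j}. C i' j' * D i' j')"
        if "i' \<in> I - {i}" for i'
        using fin j rem(3)[OF that] by (simp add: sum.remove[of J j])
      ultimately show ?thesis using fin 2(1) by (simp add: sum.remove[of I i])
    qed
    ultimately show ?thesis using p(2) by (intro exI[of _ p']) auto
  next
    case 3
    then obtain D' where D': "doubly_stochastic I J D'"
      "{(i, j) \<in> I \<times> J. D' i j \<noteq> 0} \<subset> {(i, j) \<in> I \<times> J. D i j \<noteq> 0}"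
      "(\<Sum>i\<in>I. \<Sum>j\<in>J. C i j * D' i j) \<le> (\<Sum>i\<in>I. \<Sum>j\<in>J. C i j * D i j)"
      using doubly_stochastic_smaller_support[OF fin _ less.prems(3) D, of C] by blast
    have "card {(i, j) \<in> I \<times> J. D' i j \<noteq> 0} < card {(i, j) \<in> I \<times> J. D i j \<noteq> 0}"
      by (rule psubset_card_mono[OF finS D'(2)])
    then obtain p where "bij_betw p I J"
      "(\<Sum>i\<in>I. C i (p i)) \<le> (\<Sum>i\<in>I. \<Sum>j\<in>J. C i j * D' i j)"
      using less.hyps[OF _ fin less.prems(3) D'(1)] by auto
    then show ?thesis using D'(3) by (meson order_trans)
  qed
qed

section \<open>Adjoints and unitary matrices\<close>

lemma mat_adjoint_carrier [simp]: "A \<in> carrier_mat m n \<Longrightarrow> mat_adjoint A \<in> carrier_mat n m"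
  and mat_adjoint_dim [simp]: "dim_row (mat_adjoint A) = dim_col A" "dim_col (mat_adjoint A) = dim_row A"
  by (auto simp: mat_adjoint_def)

lemma mat_adjoint_index [simp]:
  "i < dim_col A \<Longrightarrow> j < dim_row A \<Longrightarrow> mat_adjoint A $$ (i, j) = conjugate (A $$ (j, i))"
  by (simp add: mat_adjoint_def mat_of_rows_def)

lemma mat_mult_index_sum:
  "A \<in> carrier_mat m k \<Longrightarrow> B \<in> carrier_mat k n \<Longrightarrow> i < m \<Longrightarrow> j < n \<Longrightarrow>
   (A * B) $$ (i, j) = (\<Sum>l<k. A $$ (i, l) * B $$ (l, j))"
  by (auto simp: scalar_prod_def atLeast0LessThan intro!: sum.cong)

lemma mat_adjoint_mult:
  fixes A B :: "complex mat"
  assumes A: "A \<in> carrier_mat m k" and B: "B \<in> carrier_mat k n"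
  shows "mat_adjoint (A * B) = mat_adjoint B * mat_adjoint A"
proof (rule eq_matI)
  fix i j assume "i < dim_row (mat_adjoint B * mat_adjoint A)" "j < dim_col (mat_adjoint B * mat_adjoint A)"
  then have ij: "i < n" "j < m" using A B by auto
  have "(mat_adjoint B * mat_adjoint A) $$ (i, j) = (\<Sum>l<k. mat_adjoint B $$ (i, l) * mat_adjoint A $$ (l, j))"
    using A B ij by (intro mat_mult_index_sum) auto
  also have "\<dots> = (\<Sum>l<k. cnj (A $$ (j, l) * B $$ (l, i)))"
    using A B ij by (auto intro!: sum.cong)
  also have "\<dots> = cnj ((A * B) $$ (j, i))"
    using mat_mult_index_sum[OF A B ij(2,1)] by simp
  also have "\<dots> = mat_adjoint (A * B) $$ (i, j)" using A B ij by auto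
  finally show "mat_adjoint (A * B) $$ (i, j) = (mat_adjoint B * mat_adjoint A) $$ (i, j)" by simp
qed (use A B in auto)

lemma mat_adjoint_adjoint [simp]: "mat_adjoint (mat_adjoint A) = (A :: complex mat)"
  by (rule eq_matI) auto

text \<open>One of the two equations suffices, as one-sided inverses of square matrices are two-sided.\<close>

definition unitary_mat :: "nat \<Rightarrow> complex mat \<Rightarrow> bool" where
  "unitary_mat n U \<longleftrightarrow> U \<in> carrier_mat n n \<and> mat_adjoint U * U = 1\<^sub>m n"

lemma unitary_matD:
  assumes "unitary_mat n U"
  shows "U \<in> carrier_mat n n" "mat_adjoint U \<in> carrier_mat n n"
    "mat_adjoint U * U = 1\<^sub>m n" "U * mat_adjoint U = 1\<^sub>m n"
  using assms mat_mult_left_right_inverse[of "mat_adjoint U" n U]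
  by (auto simp: unitary_mat_def)

lemma unitary_mat_mult:
  assumes U: "unitary_mat n U" and V: "unitary_mat n V"
  shows "unitary_mat n (U * V)"
proof -
  note U = unitary_matD[OF U] and V = unitary_matD[OF V]
  have "mat_adjoint (U * V) * (U * V) = mat_adjoint V * (mat_adjoint U * (U * V))"
    using U V by (simp add: mat_adjoint_mult[of _ n n] assoc_mult_mat[of _ n n _ n _ n])
  also have "mat_adjoint U * (U * V) = V"
    using U V assoc_mult_mat[of "mat_adjoint U" n n U n V n] by simp
  finally show ?thesis using U V by (simp add: unitary_mat_def)
qed

lemma unitary_mat_adjoint:
  assumes U: "unitary_mat n U"
  shows "unitary_mat n (mat_adjoint U)"
  using unitary_matD[OF U] by (simp add: unitary_mat_def)

text \<open>Gram--Schmidt, started from a basis that begins with \<open>v\<close>, gives pairwise orthogonal columns;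
  dividing them by their norms makes the matrix unitary and only rescales \<open>v\<close>.\<close>

lemma unitary_completion:
  fixes v :: "complex vec"
  assumes v: "v \<in> carrier_vec n" and v0: "v \<noteq> 0\<^sub>v n"
  shows "\<exists>U c. unitary_mat n U \<and> c \<noteq> 0 \<and> col U 0 = c \<cdot>\<^sub>v v"
proof -
  interpret cof_vec_space n "TYPE(complex)" .
  define ws where "ws = gram_schmidt n (basis_completion v)"
  note b = basis_completion[OF v v0]
  note ws = gram_schmidt_result[OF b(2,4,5) ws_def]
  have n: "n \<noteq> 0"
  proof
    assume "n = 0"
    then have "v = 0\<^sub>v n" using v by (intro eq_vecI) auto
    then show False using v0 by simp
  qed
  then obtain vs where bv: "basis_completion v = v # vs"
    using b(6,7) by (cases "basis_completion v") auto
  have len: "length ws = n" using ws(4) b(6) by simp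
  have hd: "ws ! 0 = v"
    using gram_schmidt_hd[OF v, of vs] len n by (cases ws) (auto simp: bv ws_def)
  have wsc: "ws ! i \<in> carrier_vec n" if "i < n" for i using ws(3) len that by auto
  define r where "r i = sqrt (Re (ws ! i \<bullet>c ws ! i))" for i
  have orth: "(\<Sum>l<n. cnj (ws ! i $ l) * ws ! j $ l) = (if i = j then (of_real (r i))\<^sup>2 else 0)"
    if ij: "i < n" "j < n" for i j
  proof -
    have s: "(\<Sum>l<n. cnj (ws ! i $ l) * ws ! j $ l) = ws ! j \<bullet>c ws ! i"
      using wsc[OF ij(1)] wsc[OF ij(2)]
      by (auto simp: scalar_prod_def atLeast0LessThan mult.commute intro!: sum.cong)
    show ?thesis
    proof (cases "i = j")
      case True
      have "0 \<le> ws ! i \<bullet>c ws ! i" by (rule conjugate_square_ge_0_vec)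
      then have "0 \<le> Re (ws ! i \<bullet>c ws ! i)" "ws ! i \<bullet>c ws ! i = of_real (Re (ws ! i \<bullet>c ws ! i))"
        by (auto simp: less_eq_complex_def complex_eq_iff)
      then show ?thesis using True unfolding s r_def by (simp flip: of_real_power)
    next
      case False
      then show ?thesis using corthogonalD[OF ws(2), of j i] len ij unfolding s by auto
    qed
  qed
  have r0: "r i \<noteq> 0" if i: "i < n" for i
  proof -
    have "ws ! i \<bullet>c ws ! i \<noteq> 0" using corthogonalD[OF ws(2), of i i] len i by auto
    moreover have "ws ! i \<bullet>c ws ! i = (of_real (r i))\<^sup>2"
      using orth[OF i i] wsc[OF i]
      by (auto simp: scalar_prod_def atLeast0LessThan mult.commute intro!: sum.cong)
    ultimately show ?thesis by auto
  qed
  define U where "U = mat n n (\<lambda>(l, i). ws ! i $ l / of_real (r i))"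
  have U: "U \<in> carrier_mat n n" by (simp add: U_def)
  have "mat_adjoint U * U = 1\<^sub>m n"
  proof (rule eq_matI)
    fix i j assume "i < dim_row (1\<^sub>m n)" "j < dim_col (1\<^sub>m n)"
    then have ij: "i < n" "j < n" by auto
    have "(mat_adjoint U * U) $$ (i, j) = (\<Sum>l<n. cnj (ws ! i $ l) * ws ! j $ l / (of_real (r i) * of_real (r j)))"
      using U ij by (subst mat_mult_index_sum[of _ n n _ n]) (auto simp: U_def intro!: sum.cong)
    also have "\<dots> = (\<Sum>l<n. cnj (ws ! i $ l) * ws ! j $ l) / (of_real (r i) * of_real (r j))"
      by (simp add: sum_divide_distrib)
    finally show "(mat_adjoint U * U) $$ (i, j) = 1\<^sub>m n $$ (i, j)"
      using orth[OF ij] r0[OF ij(1)] r0[OF ij(2)] ij by (simp add: power2_eq_square)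
  qed (use U in auto)
  moreover have "col U 0 = (1 / of_real (r 0)) \<cdot>\<^sub>v v"
    using n hd v by (intro eq_vecI) (auto simp: U_def)
  ultimately show ?thesis using U r0[of 0] n
    by (intro exI[of _ U] exI[of _ "1 / of_real (r 0)"]) (auto simp: unitary_mat_def)
qed

section \<open>Unitary diagonalization of normal matrices\<close>

definition normal_mat :: "complex mat \<Rightarrow> bool" where
  "normal_mat A \<longleftrightarrow> mat_adjoint A * A = A * mat_adjoint A"

lemma normal_mat_unitary_conj:
  assumes A: "A \<in> carrier_mat n n" "normal_mat A" and U: "unitary_mat n U"
  shows "normal_mat (mat_adjoint U * A * U)"
proof -
  note U = unitary_matD[OF U]
  note as = assoc_mult_mat[of _ n n _ n _ n]
  note cl = mult_carrier_mat[of _ n n _ n]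
  let ?B = "mat_adjoint U * A * U"
  have adj: "mat_adjoint ?B = mat_adjoint U * mat_adjoint A * U"
    using A U by (simp add: mat_adjoint_mult[of _ n n _ n] as cl)
  have c: "U * (mat_adjoint U * X) = X" if "X \<in> carrier_mat n n" for X
    using U that as[of U "mat_adjoint U" X] by simp
  have "mat_adjoint ?B * ?B = mat_adjoint U * (mat_adjoint A * A) * U"
    unfolding adj using A U by (simp add: as c cl)
  moreover have "?B * mat_adjoint ?B = mat_adjoint U * (A * mat_adjoint A) * U"
    unfolding adj using A U by (simp add: as c cl)
  ultimately show ?thesis using A(2) by (simp add: normal_mat_def)
qed

text \<open>These are the diagonal entries of \<open>A * mat_adjoint A\<close> and of \<open>mat_adjoint A * A\<close>.\<close>

lemma normal_mat_row_norm_eq_col_norm: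
  assumes A: "A \<in> carrier_mat n n" "normal_mat A" and i: "i < n"
  shows "(\<Sum>l<n. (cmod (A $$ (i, l)))\<^sup>2) = (\<Sum>l<n. (cmod (A $$ (l, i)))\<^sup>2)"
proof -
  have "complex_of_real (\<Sum>l<n. (cmod (A $$ (i, l)))\<^sup>2) = (A * mat_adjoint A) $$ (i, i)"
    using A i by (subst mat_mult_index_sum[of _ n n _ n]) (auto simp: complex_norm_square[symmetric] intro!: sum.cong)
  also have "\<dots> = (mat_adjoint A * A) $$ (i, i)" using A(2) by (simp add: normal_mat_def)
  also have "\<dots> = complex_of_real (\<Sum>l<n. (cmod (A $$ (l, i)))\<^sup>2)"
    using A i
    by (subst mat_mult_index_sum[of _ n n _ n]) (auto simp: mult.commute[of "cnj _"] complex_norm_square[symmetric] intro!: sum.cong)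
  finally show ?thesis by (simp only: of_real_eq_iff)
qed

lemma mat_adjoint_four_block:
  fixes A :: "complex mat"
  assumes "A \<in> carrier_mat m m" "D \<in> carrier_mat n n"
  shows "mat_adjoint (four_block_mat A (0\<^sub>m m n) (0\<^sub>m n m) D) =
    four_block_mat (mat_adjoint A) (0\<^sub>m m n) (0\<^sub>m n m) (mat_adjoint D)"
  by (rule eq_matI) (use assms in auto)

lemma mult_block_diag:
  fixes A :: "complex mat"
  assumes "A \<in> carrier_mat m m" "A' \<in> carrier_mat m m" "D \<in> carrier_mat n n" "D' \<in> carrier_mat n n"
  shows "four_block_mat A (0\<^sub>m m n) (0\<^sub>m n m) D * four_block_mat A' (0\<^sub>m m n) (0\<^sub>m n m) D' =
    four_block_mat (A * A') (0\<^sub>m m n) (0\<^sub>m n m) (D * D')"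
  by (subst mult_four_block_mat[of _ m m _ n _ n _ _ m _ n]) (use assms in auto)

lemma exists_eigenvalue_complex:
  assumes A: "A \<in> carrier_mat n n" and n: "0 < n"
  shows "\<exists>e. eigenvalue (A :: complex mat) e"
proof -
  have "degree (char_poly A) = n" using degree_monic_char_poly[OF A] by simp
  then have "\<not> constant (poly (char_poly A))" using n by (simp add: constant_degree)
  then show ?thesis
    using fundamental_theorem_of_algebra eigenvalue_root_char_poly[OF A] by blast
qed

text \<open>In a unitary basis that starts with an eigenvector, the first column is zero below the
  diagonal. For a normal matrix the first row has the same norm as the first column, so the rest of
  the first row is zero as well, and the remaining diagonal block inherits normality.\<close>

lemma normal_mat_deflation:
  assumes A: "A \<in> carrier_mat (Suc m) (Suc m)" "normal_mat A"
  shows "\<exists>U e A'. unitary_mat (Suc m) U \<and> A' \<in> carrier_mat m m \<and> normal_mat A' \<and>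
    mat_adjoint U * A * U = four_block_mat (mat 1 1 (\<lambda>_. e)) (0\<^sub>m 1 m) (0\<^sub>m m 1) A'"
proof -
  let ?n = "Suc m"
  obtain e where "eigenvalue A e" using exists_eigenvalue_complex[OF A(1)] by auto
  then obtain v where v: "v \<in> carrier_vec ?n" "v \<noteq> 0\<^sub>v ?n" "A *\<^sub>v v = e \<cdot>\<^sub>v v"
    using A(1) by (auto simp: eigenvalue_def eigenvector_def)
  obtain U c where U: "unitary_mat ?n U" and c: "col U 0 = c \<cdot>\<^sub>v v"
    using unitary_completion[OF v(1,2)] by blast
  note UD = unitary_matD[OF U]
  define B where "B = mat_adjoint U * A * U"
  have B: "B \<in> carrier_mat ?n ?n" using UD A(1) by (simp add: B_def mult_carrier_mat[of _ ?n ?n _ ?n])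
  have nB: "normal_mat B" unfolding B_def by (rule normal_mat_unitary_conj[OF A U])
  have "A *\<^sub>v col U 0 = e \<cdot>\<^sub>v col U 0"
    using A(1) v unfolding c by (auto simp: mult_mat_vec[of _ ?n ?n] smult_smult_assoc mult.commute)
  then have "col (A * U) 0 = e \<cdot>\<^sub>v col U 0" by (simp only: col_mult2[OF A(1) UD(1) zero_less_Suc])
  then have AU: "(A * U) $$ (l, 0) = e * U $$ (l, 0)" if "l < ?n" for l
    using that A(1) UD(1) arg_cong[of _ _ "\<lambda>w. w $ l"] by fastforce
  have B0: "B $$ (i, 0) = (if i = 0 then e else 0)" if i: "i < ?n" for i
  proof -
    have "B $$ (i, 0) = (mat_adjoint U * (A * U)) $$ (i, 0)"
      using A UD by (simp add: B_def assoc_mult_mat[of _ ?n ?n _ ?n _ ?n]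
      mult_carrier_mat[of _ ?n ?n _ ?n])
    also have "\<dots> = (\<Sum>l<?n. mat_adjoint U $$ (i, l) * (A * U) $$ (l, 0))"
      using A UD i by (intro mat_mult_index_sum) auto
    also have "\<dots> = (\<Sum>l<?n. e * (mat_adjoint U $$ (i, l) * U $$ (l, 0)))"
      by (intro sum.cong refl) (simp add: AU del: mat_adjoint_index)
    also have "\<dots> = e * (mat_adjoint U * U) $$ (i, 0)"
      using UD i by (subst mat_mult_index_sum[of _ ?n ?n _ ?n]) (auto simp: sum_distrib_left simp del: sum.lessThan_Suc)
    finally show ?thesis using UD(3) i by simp
  qed
  \<comment> \<open>The corner entry alone exhausts the norm of the first row.\<close>
  have "(\<Sum>l<?n. (cmod (B $$ (0, l)))\<^sup>2) = (cmod e)\<^sup>2"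
  proof -
    have "(\<Sum>l<?n. (cmod (B $$ (0, l)))\<^sup>2) = (\<Sum>l<?n. (cmod (B $$ (l, 0)))\<^sup>2)"
      by (rule normal_mat_row_norm_eq_col_norm[OF B nB]) simp
    also have "\<dots> = (\<Sum>l<?n. if l = 0 then (cmod e)\<^sup>2 else 0)"
      by (intro sum.cong refl) (simp add: B0)
    finally show ?thesis by (simp del: sum.lessThan_Suc)
  qed
  then have z: "(\<Sum>l\<in>{..<?n} - {0}. (cmod (B $$ (0, l)))\<^sup>2) = 0"
    using B0[of 0] by (simp add: sum.remove[of "{..<?n}" 0] del: sum.lessThan_Suc)
  have B0': "B $$ (0, l) = 0" if "l < ?n" "l \<noteq> 0" for l
    using z that by (subst (asm) sum_nonneg_eq_0_iff) auto
  define A' where "A' = mat m m (\<lambda>(i, j). B $$ (Suc i, Suc j))"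
  have A': "A' \<in> carrier_mat m m" by (simp add: A'_def)
  define E where "E = mat 1 1 (\<lambda>_. e)"
  have E: "E \<in> carrier_mat 1 1" by (simp add: E_def)
  have Bb: "B = four_block_mat E (0\<^sub>m 1 m) (0\<^sub>m m 1) A'"
    by (rule eq_matI) (use B A' B0 B0' in \<open>auto simp: E_def A'_def\<close>)
  have "mat_adjoint B * B = four_block_mat (mat_adjoint E * E) (0\<^sub>m 1 m) (0\<^sub>m m 1) (mat_adjoint A' * A')"
    "B * mat_adjoint B = four_block_mat (E * mat_adjoint E) (0\<^sub>m 1 m) (0\<^sub>m m 1) (A' * mat_adjoint A')"
    unfolding Bb mat_adjoint_four_block[OF E A'] using E A' by (auto intro!: mult_block_diag)
  then have eq: "four_block_mat (mat_adjoint E * E) (0\<^sub>m 1 m) (0\<^sub>m m 1) (mat_adjoint A' * A') =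
     four_block_mat (E * mat_adjoint E) (0\<^sub>m 1 m) (0\<^sub>m m 1) (A' * mat_adjoint A')"
    using nB by (simp add: normal_mat_def)
  have "mat_adjoint A' * A' = A' * mat_adjoint A'"
  proof (rule eq_matI)
    fix i j assume "i < dim_row (A' * mat_adjoint A')" "j < dim_col (A' * mat_adjoint A')"
    then have ij: "i < m" "j < m" using A' by auto
    show "(mat_adjoint A' * A') $$ (i, j) = (A' * mat_adjoint A') $$ (i, j)"
      using arg_cong[OF eq, of "\<lambda>M. M $$ (Suc i, Suc j)"] ij A' E
      by (simp del: index_mult_mat(1))
  qed (use A' in auto)
  then show ?thesis using U A' Bb by (auto simp: normal_mat_def B_def E_def)
qed

text \<open>The spectral theorem, by repeated deflation.\<close>

theorem normal_mat_unitarily_diagonalizable: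
  assumes "A \<in> carrier_mat n n" "normal_mat A"
  shows "\<exists>U d. unitary_mat n U \<and> mat_adjoint U * A * U = mat_diag n d"
  using assms
proof (induction n arbitrary: A)
  case 0
  then show ?case
    by (intro exI[of _ "1\<^sub>m 0"] exI[of _ "\<lambda>_. 0"]) (auto simp: unitary_mat_def mat_diag_def intro!: eq_matI)
next
  case (Suc m)
  let ?n = "Suc m"
  obtain W e A' where W: "unitary_mat ?n W" and A': "A' \<in> carrier_mat m m" "normal_mat A'"
    and WA: "mat_adjoint W * A * W = four_block_mat (mat 1 1 (\<lambda>_. e)) (0\<^sub>m 1 m) (0\<^sub>m m 1) A'"
    using normal_mat_deflation[OF Suc.prems] by blast
  obtain V d where V: "unitary_mat m V" and Vd: "mat_adjoint V * A' * V = mat_diag m d"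
    using Suc.IH[OF A'] by blast
  note VD = unitary_matD[OF V] and WD = unitary_matD[OF W]
  define E where "E = mat 1 1 (\<lambda>_. e)"
  have E: "E \<in> carrier_mat 1 1" by (simp add: E_def)
  define V1 where "V1 = four_block_mat (1\<^sub>m 1) (0\<^sub>m 1 m) (0\<^sub>m m 1) V"
  have V1a: "mat_adjoint V1 = four_block_mat (1\<^sub>m 1) (0\<^sub>m 1 m) (0\<^sub>m m 1) (mat_adjoint V)"
  proof -
    have "mat_adjoint (1\<^sub>m 1) = (1\<^sub>m 1 :: complex mat)" by (rule eq_matI) auto
    then show ?thesis using VD by (simp add: V1_def mat_adjoint_four_block)
  qed
  have V1: "V1 \<in> carrier_mat ?n ?n" using VD by (auto simp: V1_def)
  have "mat_adjoint V1 * V1 = four_block_mat (1\<^sub>m 1) (0\<^sub>m 1 m) (0\<^sub>m m 1) (1\<^sub>m m)"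
    unfolding V1a unfolding V1_def using VD by (subst mult_block_diag) auto
  also have "\<dots> = 1\<^sub>m ?n" by (rule eq_matI) auto
  finally have V1u: "unitary_mat ?n V1" using V1 by (simp add: unitary_mat_def)
  define U where "U = W * V1"
  have "mat_adjoint U * A * U = mat_adjoint V1 * (mat_adjoint W * A * W) * V1"
    using WD V1 Suc.prems(1) unfolding U_def
    by (simp add: mat_adjoint_mult[of _ ?n ?n _ ?n] assoc_mult_mat[of _ ?n ?n _ ?n _ ?n]
      mult_carrier_mat[of _ ?n ?n _ ?n])
  also have "\<dots> = four_block_mat E (0\<^sub>m 1 m) (0\<^sub>m m 1) (mat_diag m d)"
  proof -
    have "mat_adjoint V * A' \<in> carrier_mat m m" using VD A' by (intro mult_carrier_mat)
    then show ?thesis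
      unfolding WA E_def[symmetric] V1a unfolding V1_def using VD A' E
      by (simp only: mult_block_diag one_carrier_mat Vd left_mult_one_mat[OF E] right_mult_one_mat[OF E])
  qed
  also have "\<dots> = mat_diag ?n (\<lambda>i. case i of 0 \<Rightarrow> e | Suc j \<Rightarrow> d j)"
    by (rule eq_matI) (auto simp: E_def mat_diag_def split: nat.splits)
  finally show ?case using unitary_mat_mult[OF W V1u] U_def by blast
qed

section \<open>The Frobenius norm and the Hoffman--Wielandt inequality\<close>

definition mat_sq_norm :: "complex mat \<Rightarrow> real" where
  "mat_sq_norm A = (\<Sum>j<dim_col A. \<Sum>i<dim_row A. (cmod (A $$ (i, j)))\<^sup>2)"

text \<open>The trace formula for the Frobenius norm, which reduces unitary invariance to
  \<open>mat_adjoint (U * A) * (U * A) = mat_adjoint A * A\<close>.\<close>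

lemma mat_sq_norm_gram:
  assumes A: "A \<in> carrier_mat m n"
  shows "complex_of_real (mat_sq_norm A) = (\<Sum>j<n. (mat_adjoint A * A) $$ (j, j))"
proof -
  have "(mat_adjoint A * A) $$ (j, j) = complex_of_real (\<Sum>i<m. (cmod (A $$ (i, j)))\<^sup>2)" if "j < n" for j
    using A that
    by (subst mat_mult_index_sum[of _ n m _ n])
      (auto simp: mult.commute[of "cnj _"] complex_norm_square[symmetric] intro!: sum.cong)
  then show ?thesis using A by (auto simp: mat_sq_norm_def)
qed

lemma mat_sq_norm_adjoint: "mat_sq_norm (mat_adjoint A) = mat_sq_norm A"
  unfolding mat_sq_norm_def by (subst sum.swap) (auto intro!: sum.cong)

lemma mat_sq_norm_unitary_left:
  assumes U: "unitary_mat n U" and A: "A \<in> carrier_mat n n"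
  shows "mat_sq_norm (U * A) = mat_sq_norm A"
proof -
  note UD = unitary_matD[OF U]
  have "mat_adjoint U * (U * A) = A"
    using UD A assoc_mult_mat[of "mat_adjoint U" n n U n A n] by simp
  then have "mat_adjoint (U * A) * (U * A) = mat_adjoint A * A"
    using UD A
    by (simp add: mat_adjoint_mult[of _ n n _ n] assoc_mult_mat[of _ n n _ n _ n] mult_carrier_mat[of _ n n _ n])
  then have "complex_of_real (mat_sq_norm (U * A)) = complex_of_real (mat_sq_norm A)"
    using mat_sq_norm_gram[OF A] mat_sq_norm_gram[of "U * A" n n] UD A by simp
  then show ?thesis by simp
qed

lemma mat_sq_norm_unitary_right:
  assumes U: "unitary_mat n U" and A: "A \<in> carrier_mat n n"
  shows "mat_sq_norm (A * U) = mat_sq_norm A"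
proof -
  have "mat_sq_norm (A * U) = mat_sq_norm (mat_adjoint U * mat_adjoint A)"
    using mat_sq_norm_adjoint[of "A * U"] mat_adjoint_mult[OF A unitary_matD(1)[OF U]] by simp
  also have "\<dots> = mat_sq_norm A"
    using mat_sq_norm_unitary_left[OF unitary_mat_adjoint[OF U], of "mat_adjoint A"] A
    by (simp add: mat_sq_norm_adjoint)
  finally show ?thesis .
qed

lemma unitary_mat_col_norm:
  assumes U: "unitary_mat n U" and j: "j < n"
  shows "(\<Sum>i<n. (cmod (U $$ (i, j)))\<^sup>2) = 1"
proof -
  note UD = unitary_matD[OF U]
  have "complex_of_real (\<Sum>i<n. (cmod (U $$ (i, j)))\<^sup>2) = (mat_adjoint U * U) $$ (j, j)"
    using UD(1) j
    by (subst mat_mult_index_sum[of _ n n _ n])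
      (auto simp: mult.commute[of "cnj _"] complex_norm_square[symmetric] intro!: sum.cong)
  then show ?thesis using UD(3) j by (metis index_one_mat(1) of_real_eq_1_iff)
qed

lemma unitary_mat_row_norm:
  assumes U: "unitary_mat n U" and i: "i < n"
  shows "(\<Sum>j<n. (cmod (U $$ (i, j)))\<^sup>2) = 1"
  using unitary_mat_col_norm[OF unitary_mat_adjoint[OF U] i] unitary_matD(1)[OF U] i by simp

text \<open>With \<open>W = mat_adjoint U * V\<close>, the two terms of the difference become \<open>W * mat_diag n e\<close> and
  \<open>mat_diag n d * W\<close>.\<close>

lemma diagonalized_difference_index:
  assumes U: "unitary_mat n U" and V: "unitary_mat n V"
    and A: "A \<in> carrier_mat n n" "mat_adjoint U * A * U = mat_diag n d"
    and B: "B \<in> carrier_mat n n" "mat_adjoint V * B * V = mat_diag n e"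
    and kl: "k < n" "l < n"
  shows "(mat_adjoint U * (B - A) * V) $$ (k, l) = (e l - d k) * (mat_adjoint U * V) $$ (k, l)"
proof -
  note UD = unitary_matD[OF U] and VD = unitary_matD[OF V]
  note cl = mult_carrier_mat[of _ n n _ n] and as = assoc_mult_mat[of _ n n _ n _ n]
  let ?W = "mat_adjoint U * V"
  have W: "?W \<in> carrier_mat n n" using UD VD by (intro mult_carrier_mat)
  have 1: "V * (mat_adjoint V * X) = X" if "X \<in> carrier_mat n n" for X
    using VD that as[of V "mat_adjoint V" X] by simp
  have 2: "U * (mat_adjoint U * X) = X" if "X \<in> carrier_mat n n" for X
    using UD that as[of U "mat_adjoint U" X] by simp
  have "mat_adjoint U * (B - A) * V = mat_adjoint U * B * V - mat_adjoint U * A * V"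
    using UD VD A(1) B(1)
    by (simp add: mult_minus_distrib_mat[of _ n n _ n] minus_mult_distrib_mat[of _ n n _ _ n] cl)
  also have "mat_adjoint U * B * V = ?W * mat_diag n e"
    unfolding B(2)[symmetric] using UD VD B(1) by (simp add: as cl 1)
  also have "mat_adjoint U * A * V = mat_diag n d * ?W"
    unfolding A(2)[symmetric] using UD VD A(1) by (simp add: as cl 2)
  finally show ?thesis using kl W
    by (simp add: mat_diag_mult_left[OF W] mat_diag_mult_right[OF W] algebra_simps del: index_mult_mat(1))
qed

lemma order_prod_linear_factors:
  "Polynomial.order z (\<Prod>x\<leftarrow>xs. [:- x, 1:]) = count_list xs (z :: complex)"
proof (induction xs)
  case Nil
  then show ?case by (simp add: order_1_eq_0)
next
  case (Cons x xs)
  have "[:- x, 1:] * (\<Prod>x\<leftarrow>xs. [:- x, 1:]) \<noteq> 0"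
    by (auto simp: prod_list_zero_iff simp del: mult_pCons_left)
  then show ?case
    using Cons by (simp add: Polynomial.order_mult order_linear' del: mult_pCons_left)
qed

lemma order_char_poly_diagonalized:
  assumes A: "A \<in> carrier_mat n n" and U: "unitary_mat n U"
    and D: "mat_adjoint U * A * U = mat_diag n d"
  shows "Polynomial.order z (char_poly A) = card {k \<in> {..<n}. d k = z}"
proof -
  note UD = unitary_matD[OF U]
  have "similar_mat_wit (mat_diag n d) A (mat_adjoint U) U"
    by (rule similar_mat_witI[of _ _ n]) (use UD A D in auto)
  then have "char_poly A = char_poly (mat_diag n d)"
    by (metis char_poly_similar similar_mat_def)
  also have "\<dots> = (\<Prod>x\<leftarrow>diag_mat (mat_diag n d). [:- x, 1:])"
    by (rule char_poly_upper_triangular[of _ n]) (auto simp: mat_diag_def)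
  also have "diag_mat (mat_diag n d) = map d [0..<n]"
    by (auto simp: diag_mat_def mat_diag_def)
  finally have "Polynomial.order z (char_poly A) = length (filter ((=) z) (map d [0..<n]))"
    by (simp only: order_prod_linear_factors count_list_eq_length_filter)
  also have "\<dots> = card {k. k < n \<and> z = d k}"
    by (simp add: length_filter_conv_card cong: conj_cong)
  also have "{k. k < n \<and> z = d k} = {k \<in> {..<n}. d k = z}" by auto
  finally show ?thesis .
qed

text \<open>Two families that take each value equally often differ by a bijection of their index sets. It
  matches an enumeration of the eigenvalues with the diagonal entries of a diagonal form.\<close>

lemma equal_fibre_cards_bij:
  assumes fin: "finite I" "finite J"
    and card: "\<And>z. card {i \<in> I. f i = z} = card {j \<in> J. g j = z}"
  shows "\<exists>b. bij_betw b I J \<and> (\<forall>i\<in>I. g (b i) = f i)"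
proof -
  have "\<exists>h. bij_betw h {i \<in> I. f i = z} {j \<in> J. g j = z}" for z
    using fin card by (intro finite_same_card_bij) auto
  then obtain h where h: "\<And>z. bij_betw (h z) {i \<in> I. f i = z} {j \<in> J. g j = z}" by metis
  define b where "b i = h (f i) i" for i
  have b: "b i \<in> J" "g (b i) = f i" if "i \<in> I" for i
    using bij_betwE[OF h[of "f i"]] that by (auto simp: b_def)
  have "inj_on b I"
  proof (rule inj_onI)
    fix i i' assume i: "i \<in> I" "i' \<in> I" "b i = b i'"
    then have "f i = f i'" using b by metis
    then show "i = i'"
      using bij_betw_imp_inj_on[OF h[of "f i"]] i by (auto simp: b_def inj_on_def)
  qed
  moreover have "J \<subseteq> b ` I"
  proof
    fix j assume "j \<in> J"
    then have "j \<in> h (g j) ` {i \<in> I. f i = g j}" using bij_betw_imp_surj_on[OF h[of "g j"]] by simp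
    then obtain i where "i \<in> I" "f i = g j" "j = h (g j) i" by blast
    then have "j = b i" by (simp add: b_def)
    with \<open>i \<in> I\<close> show "j \<in> b ` I" by blast
  qed
  ultimately show ?thesis using b by (intro exI[of _ b]) (auto simp: bij_betw_def)
qed

text \<open>With \<open>U\<close> diagonalizing \<open>A\<close> and \<open>V\<close> diagonalizing \<open>B\<close>, the squared moduli of the entries of
  \<open>mat_adjoint U * V\<close> form a doubly stochastic matrix, and the squared norm
  of \<open>B - A\<close> is the cost of that matrix when the position \<open>(i, j)\<close> has the price
  \<open>|mu j - lam i|\<^sup>2\<close>.\<close>

theorem Hoffman_Wielandt:
  fixes A B :: "complex mat" and lam mu :: "'i \<Rightarrow> complex"
  assumes A: "A \<in> carrier_mat n n" "normal_mat A" and B: "B \<in> carrier_mat n n" "normal_mat B"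
    and I: "finite I"
    and lam: "\<And>z. card {i \<in> I. lam i = z} = Polynomial.order z (char_poly A)"
    and mu: "\<And>z. card {i \<in> I. mu i = z} = Polynomial.order z (char_poly B)"
  shows "\<exists>p. p permutes I \<and> (\<Sum>i\<in>I. (cmod (mu (p i) - lam i))\<^sup>2) \<le> mat_sq_norm (B - A)"
proof -
  obtain U d where U: "unitary_mat n U" and d: "mat_adjoint U * A * U = mat_diag n d"
    using normal_mat_unitarily_diagonalizable[OF A] by blast
  obtain V e where V: "unitary_mat n V" and e: "mat_adjoint V * B * V = mat_diag n e"
    using normal_mat_unitarily_diagonalizable[OF B] by blast
  obtain f where f: "bij_betw f I {..<n}" "\<And>i. i \<in> I \<Longrightarrow> d (f i) = lam i"
    using equal_fibre_cards_bij[of I "{..<n}" lam d] I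
    by (auto simp: lam order_char_poly_diagonalized[OF A(1) U d])
  obtain g where g: "bij_betw g I {..<n}" "\<And>i. i \<in> I \<Longrightarrow> e (g i) = mu i"
    using equal_fibre_cards_bij[of I "{..<n}" mu e] I
    by (auto simp: mu order_char_poly_diagonalized[OF B(1) V e])
  note UD = unitary_matD[OF U] and VD = unitary_matD[OF V]
  define W where "W = mat_adjoint U * V"
  have W: "unitary_mat n W"
    unfolding W_def by (rule unitary_mat_mult[OF unitary_mat_adjoint[OF U] V])
  define D where "D i j = (cmod (W $$ (f i, g j)))\<^sup>2" for i j
  define C where "C i j = (cmod (mu j - lam i))\<^sup>2" for i j
  have fI: "f i < n" and gI: "g i < n" if "i \<in> I" for i
    using bij_betwE[OF f(1)] bij_betwE[OF g(1)] that by auto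
  have "doubly_stochastic I I D"
    using unitary_mat_row_norm[OF W] unitary_mat_col_norm[OF W] fI gI
      sum.reindex_bij_betw[OF g(1), of "\<lambda>l. (cmod (W $$ (f _, l)))\<^sup>2"]
      sum.reindex_bij_betw[OF f(1), of "\<lambda>k. (cmod (W $$ (k, g _)))\<^sup>2"]
    by (simp add: doubly_stochastic_def D_def)
  then obtain p where p: "bij_betw p I I"
    "(\<Sum>i\<in>I. C i (p i)) \<le> (\<Sum>i\<in>I. \<Sum>j\<in>I. C i j * D i j)"
    using doubly_stochastic_cost_ge_assignment[OF I I refl] by blast
  have "(\<Sum>i\<in>I. \<Sum>j\<in>I. C i j * D i j) =
      (\<Sum>i\<in>I. \<Sum>j\<in>I. (cmod ((e (g j) - d (f i)) * W $$ (f i, g j)))\<^sup>2)"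
    by (intro sum.cong refl) (simp add: C_def D_def f g norm_mult power_mult_distrib)
  also have "\<dots> = (\<Sum>i\<in>I. \<Sum>l<n. (cmod ((e l - d (f i)) * W $$ (f i, l)))\<^sup>2)"
    by (intro sum.cong refl sum.reindex_bij_betw[OF g(1)])
  also have "\<dots> = (\<Sum>k<n. \<Sum>l<n. (cmod ((e l - d k) * W $$ (k, l)))\<^sup>2)"
    by (rule sum.reindex_bij_betw[OF f(1)])
  also have "\<dots> = (\<Sum>k<n. \<Sum>l<n. (cmod ((mat_adjoint U * (B - A) * V) $$ (k, l)))\<^sup>2)"
    unfolding W_def
    by (intro sum.cong refl) (simp only: lessThan_iff diagonalized_difference_index[OF U V A(1) d B(1) e])
  also have "\<dots> = mat_sq_norm (mat_adjoint U * (B - A) * V)"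
    unfolding mat_sq_norm_def using UD VD by (subst sum.swap) simp
  also have "\<dots> = mat_sq_norm (mat_adjoint U * (B - A))"
    using A(1) UD by (intro mat_sq_norm_unitary_right[OF V] mult_carrier_mat minus_carrier_mat)
  also have "\<dots> = mat_sq_norm (B - A)"
    using A(1) by (intro mat_sq_norm_unitary_left[OF unitary_mat_adjoint[OF U]] minus_carrier_mat)
  finally have "(\<Sum>i\<in>I. C i (p i)) \<le> mat_sq_norm (B - A)" using p(2) by simp
  moreover define q where "q i = (if i \<in> I then p i else i)" for i
  moreover have "q permutes I"
  proof (rule bij_imp_permutes)
    show "bij_betw q I I" using p(1) by (subst bij_betw_cong[of _ q p]) (auto simp: q_def)
  qed (simp add: q_def)
  ultimately show ?thesis by (intro exI[of _ q]) (simp add: C_def)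
qed

section \<open>Block circulant matrices\<close>

text \<open>The new row or column number after a cyclic shift by \<open>c\<close> blocks of length \<open>n\<close>.\<close>

definition block_shift :: "nat \<Rightarrow> nat \<Rightarrow> nat \<Rightarrow> nat \<Rightarrow> nat" where
  "block_shift n n3 c i = (i + c * n) mod (n * n3)"

lemma block_shift_less: "0 < n \<Longrightarrow> 0 < n3 \<Longrightarrow> block_shift n n3 c i < n * n3"
  by (simp add: block_shift_def)

lemma block_shift_mod: "block_shift n n3 c i mod n = i mod n"
  by (simp add: block_shift_def mod_mod_cancel)

lemma block_shift_div:
  assumes "0 < n"
  shows "block_shift n n3 c i div n = (i div n + c) mod n3"
  using assms by (simp add: block_shift_def mod_mult2_eq add.commute)

lemma block_shift_bij:
  assumes "0 < n" "0 < n3"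
  shows "bij_betw (block_shift n n3 c) {..<n * n3} {..<n * n3}"
proof -
  have "inj_on (block_shift n n3 c) {..<n * n3}"
  proof (rule inj_onI)
    fix i j assume ij: "i \<in> {..<n * n3}" "j \<in> {..<n * n3}"
      and eq: "block_shift n n3 c i = block_shift n n3 c j"
    have "int (i + c * n) mod int (n * n3) = int (j + c * n) mod int (n * n3)"
      using eq by (simp only: block_shift_def flip: zmod_int)
    then have "int (n * n3) dvd int i - int j" by (simp add: mod_eq_dvd_iff)
    then have "int i mod int (n * n3) = int j mod int (n * n3)" by (simp add: mod_eq_dvd_iff)
    then have "i mod (n * n3) = j mod (n * n3)" by (simp only: of_nat_eq_iff flip: zmod_int)
    then show "i = j" using ij by simp
  qed
  moreover have "block_shift n n3 c ` {..<n * n3} \<subseteq> {..<n * n3}"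
    using block_shift_less[OF assms] by auto
  ultimately show ?thesis by (simp add: bij_betw_def endo_inj_surj)
qed

text \<open>Being block circulant is expressed by shift invariance rather than through a generating tensor:
  invariance passes to products and adjoints directly by reindexing.\<close>

definition block_circulant :: "nat \<Rightarrow> nat \<Rightarrow> 'a mat \<Rightarrow> bool" where
  "block_circulant n n3 M \<longleftrightarrow> M \<in> carrier_mat (n * n3) (n * n3) \<and>
     (\<forall>c i j. i < n * n3 \<longrightarrow> j < n * n3 \<longrightarrow>
        M $$ (block_shift n n3 c i, block_shift n n3 c j) = M $$ (i, j))"

lemma block_circulantD:
  assumes "block_circulant n n3 M"
  shows "M \<in> carrier_mat (n * n3) (n * n3)"
    "i < n * n3 \<Longrightarrow> j < n * n3 \<Longrightarrow> M $$ (block_shift n n3 c i, block_shift n n3 c j) = M $$ (i, j)"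
  using assms by (auto simp: block_circulant_def)

lemma block_shift_to_first_column:
  assumes "0 < n" "j < n * n3"
  shows "block_shift n n3 (n3 - j div n) j = j mod n"
proof -
  have "j div n < n3" using assms by (simp add: less_mult_imp_div_less mult.commute)
  then have "block_shift n n3 (n3 - j div n) j div n = 0" using assms by (simp add: block_shift_div)
  then show ?thesis
    using div_mult_mod_eq[of "block_shift n n3 (n3 - j div n) j" n] block_shift_mod[of n n3 _ j] by simp
qed

text \<open>A shift moves any entry into the first block column.\<close>

lemma block_circulant_eqI:
  assumes M: "block_circulant n n3 M" and L: "block_circulant n n3 L" and pos: "0 < n" "0 < n3"
    and eq: "\<And>i j. i < n * n3 \<Longrightarrow> j < n \<Longrightarrow> M $$ (i, j) = L $$ (i, j)"
  shows "M = L"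
proof (rule eq_matI)
  note MD = block_circulantD[OF M] and LD = block_circulantD[OF L]
  fix i j assume "i < dim_row L" "j < dim_col L"
  then have ij: "i < n * n3" "j < n * n3" using LD(1) by auto
  let ?s = "block_shift n n3 (n3 - j div n)"
  have "M $$ (i, j) = M $$ (?s i, j mod n)"
    using MD(2)[OF ij, of "n3 - j div n"] block_shift_to_first_column[OF pos(1) ij(2)] by simp
  also have "\<dots> = L $$ (?s i, j mod n)"
    using pos by (intro eq block_shift_less) auto
  also have "\<dots> = L $$ (i, j)"
    using LD(2)[OF ij, of "n3 - j div n"] block_shift_to_first_column[OF pos(1) ij(2)] by simp
  finally show "M $$ (i, j) = L $$ (i, j)" .
qed (use block_circulantD(1)[OF M] block_circulantD(1)[OF L] in auto)

lemma block_circulant_mult: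
  fixes M L :: "'a :: comm_ring_1 mat"
  assumes M: "block_circulant n n3 M" and L: "block_circulant n n3 L" and pos: "0 < n" "0 < n3"
  shows "block_circulant n n3 (M * L)"
proof -
  note MD = block_circulantD[OF M] and LD = block_circulantD[OF L]
  let ?N = "n * n3"
  have "(M * L) $$ (block_shift n n3 c i, block_shift n n3 c j) = (M * L) $$ (i, j)"
    if ij: "i < ?N" "j < ?N" for c i j
  proof -
    let ?s = "block_shift n n3 c"
    have "(M * L) $$ (?s i, ?s j) = (\<Sum>l<?N. M $$ (?s i, l) * L $$ (l, ?s j))"
      using mat_mult_index_sum[OF MD(1) LD(1)] block_shift_less[OF pos] by blast
    also have "\<dots> = (\<Sum>l<?N. M $$ (?s i, ?s l) * L $$ (?s l, ?s j))"
      by (rule sum.reindex_bij_betw[OF block_shift_bij[OF pos], symmetric])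
    also have "\<dots> = (\<Sum>l<?N. M $$ (i, l) * L $$ (l, j))"
      using ij by (intro sum.cong refl) (simp add: MD(2) LD(2))
    also have "\<dots> = (M * L) $$ (i, j)"
      using MD(1) LD(1) ij by (intro mat_mult_index_sum[symmetric])
    finally show ?thesis .
  qed
  then show ?thesis using MD(1) LD(1) by (auto simp: block_circulant_def)
qed

lemma block_circulant_adjoint:
  fixes M :: "complex mat"
  assumes M: "block_circulant n n3 M" and pos: "0 < n" "0 < n3"
  shows "block_circulant n n3 (mat_adjoint M)"
  using block_circulantD[OF M] block_shift_less[OF pos] by (auto simp: block_circulant_def)

section \<open>The block circulant matrix of a tensor\<close>

lemma bcirc_index:
  assumes A: "A \<in> carrier_tensor n n n3" and "0 < n3" and "i < n * n3" "j < n * n3"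
  shows "bcirc A $$ (i, j) =
    A ! nat ((int (i div n) - int (j div n)) mod int n3) $$ (i mod n, j mod n)"
  using assms carrier_tensorD[OF A] by (simp add: bcirc_def Let_def)

lemma bcirc_first_column:
  assumes A: "A \<in> carrier_tensor n n n3" and pos: "0 < n" "0 < n3" and i: "i < n * n3" and j: "j < n"
  shows "bcirc A $$ (i, j) = A ! (i div n) $$ (i mod n, j)"
proof -
  have "i div n < n3" using i by (simp add: less_mult_imp_div_less mult.commute)
  moreover have "j < n * n3" using pos j by (simp add: less_le_trans[OF j])
  ultimately show ?thesis using bcirc_index[OF A pos(2) i] j by simp
qed

lemma block_circulant_bcirc:
  assumes A: "A \<in> carrier_tensor n n n3" and pos: "0 < n" "0 < n3"
  shows "block_circulant n n3 (bcirc A)"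
proof -
  have "bcirc A $$ (block_shift n n3 c i, block_shift n n3 c j) = bcirc A $$ (i, j)"
    if ij: "i < n * n3" "j < n * n3" for c i j
  proof -
    have "(int ((i div n + c) mod n3) - int ((j div n + c) mod n3)) mod int n3 =
        (int (i div n) - int (j div n)) mod int n3"
      by (simp add: zmod_int mod_diff_eq)
    then show ?thesis
      using bcirc_index[OF A pos(2)] block_shift_less[OF pos] ij pos
      by (simp add: block_shift_mod block_shift_div)
  qed
  then show ?thesis using bcirc_carrier[OF A pos(2)] by (simp add: block_circulant_def)
qed

text \<open>Numbering the slices modulo \<open>n3\<close>, the adjoint reverses their order about slice 0.\<close>

lemma t_adjoint_nth:
  assumes A: "A \<in> carrier_tensor n n n3" and k: "k < n3"
  shows "t_adjoint A ! k = mat_adjoint (A ! ((n3 - k) mod n3))"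
proof -
  obtain S Ss where S: "A = S # Ss" using k carrier_tensorD(1)[OF A] by (cases A) auto
  have len: "length Ss = n3 - 1" using carrier_tensorD(1)[OF A] S by simp
  show ?thesis
  proof (cases k)
    case 0
    then show ?thesis by (simp add: S)
  next
    case (Suc m)
    then have "rev (map mat_adjoint Ss) ! m = mat_adjoint (Ss ! (n3 - 1 - Suc m))"
      using k len by (simp add: rev_nth)
    moreover have "(n3 - k) mod n3 = Suc (n3 - 1 - Suc m)" using k Suc by simp
    ultimately show ?thesis by (simp add: S Suc)
  qed
qed

lemma t_adjoint_carrier:
  assumes A: "A \<in> carrier_tensor n n n3"
  shows "t_adjoint A \<in> carrier_tensor n n n3"
  using A by (cases A) (auto simp: carrier_tensor_def)

lemma bcirc_t_adjoint:
  assumes A: "A \<in> carrier_tensor n n n3" and pos: "0 < n" "0 < n3"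
  shows "bcirc (t_adjoint A) = mat_adjoint (bcirc A)"
proof (rule block_circulant_eqI[OF _ _ pos])
  note A' = t_adjoint_carrier[OF A] and cA = bcirc_carrier[OF A pos(2)]
  show "block_circulant n n3 (bcirc (t_adjoint A))" by (rule block_circulant_bcirc[OF A' pos])
  show "block_circulant n n3 (mat_adjoint (bcirc A))"
    by (rule block_circulant_adjoint[OF block_circulant_bcirc[OF A pos] pos])
  fix i j assume i: "i < n * n3" and j: "j < n"
  have jN: "j < n * n3" using pos j by (simp add: less_le_trans[OF j])
  have k: "i div n < n3" using i by (simp add: less_mult_imp_div_less mult.commute)
  have neg: "nat ((- int (i div n)) mod int n3) = (n3 - i div n) mod n3"
  proof -
    have "(- int (i div n)) mod int n3 = (int n3 - int (i div n)) mod int n3" by simp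
    also have "\<dots> = int ((n3 - i div n) mod n3)" using k by (simp add: zmod_int of_nat_diff)
    finally show ?thesis by simp
  qed
  have m: "(n3 - i div n) mod n3 < n3" using pos by simp
  have "bcirc (t_adjoint A) $$ (i, j) = mat_adjoint (A ! ((n3 - i div n) mod n3)) $$ (i mod n, j)"
    using bcirc_first_column[OF A' pos i j] t_adjoint_nth[OF A k] by simp
  also have "\<dots> = cnj (A ! ((n3 - i div n) mod n3) $$ (j, i mod n))"
    using carrier_tensorD[OF A] m j pos by simp
  also have "\<dots> = cnj (bcirc A $$ (j, i))"
    using bcirc_index[OF A pos(2) jN i] j neg by simp
  finally show "bcirc (t_adjoint A) $$ (i, j) = mat_adjoint (bcirc A) $$ (i, j)"
    using cA i jN by simp
qed

text \<open>The t-product multiplies \<open>bcirc A\<close> by \<open>t_unfold B\<close>, which is the first block column of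
  \<open>bcirc B\<close>.\<close>

lemma t_unfold_t_prod_index:
  fixes A B :: "'a :: comm_ring_1 tensor"
  assumes A: "A \<in> carrier_tensor n n n3" and B: "B \<in> carrier_tensor n n n3" and pos: "0 < n" "0 < n3"
    and ij: "i < n * n3" "j < n"
  shows "t_unfold (A *\<^sub>t B) $$ (i, j) = (bcirc A * bcirc B) $$ (i, j)"
proof -
  note cA = bcirc_carrier[OF A pos(2)] and cB = bcirc_carrier[OF B pos(2)]
    and uB = t_unfold_carrier[OF B pos(2)]
  have jN: "j < n * n3" using pos ij by (simp add: less_le_trans[OF ij(2)])
  have "bcirc A * t_unfold B \<in> carrier_mat (n * n3) n" using cA uB by simp
  then have "t_unfold (A *\<^sub>t B) = bcirc A * t_unfold B"
    using carrier_tensorD(1)[OF A] by (simp add: t_prod_def t_unfold_fold pos)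
  then have "t_unfold (A *\<^sub>t B) $$ (i, j) = (\<Sum>l<n * n3. bcirc A $$ (i, l) * t_unfold B $$ (l, j))"
    using mat_mult_index_sum[OF cA uB ij] by simp
  also have "\<dots> = (\<Sum>l<n * n3. bcirc A $$ (i, l) * bcirc B $$ (l, j))"
    using carrier_tensorD[OF B] ij pos
    by (intro sum.cong refl) (simp add: bcirc_first_column[OF B pos] t_unfold_def Let_def)
  also have "\<dots> = (bcirc A * bcirc B) $$ (i, j)"
    using mat_mult_index_sum[OF cA cB ij(1) jN] by simp
  finally show ?thesis .
qed

text \<open>Both products are block circulant, and the normality of the tensor is the equality of their
  first block columns.\<close>

lemma normal_mat_bcirc:
  assumes A: "A \<in> carrier_tensor n n n3" and pos: "0 < n" "0 < n3" and N: "t_normal A"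
  shows "normal_mat (bcirc A)"
proof -
  note A' = t_adjoint_carrier[OF A]
  note bA = block_circulant_bcirc[OF A pos] and bA' = block_circulant_bcirc[OF A' pos]
  have "bcirc (t_adjoint A) * bcirc A = bcirc A * bcirc (t_adjoint A)"
  proof (rule block_circulant_eqI[OF _ _ pos])
    fix i j assume "i < n * n3" "j < n"
    then show "(bcirc (t_adjoint A) * bcirc A) $$ (i, j) = (bcirc A * bcirc (t_adjoint A)) $$ (i, j)"
      using t_unfold_t_prod_index[OF A A' pos] t_unfold_t_prod_index[OF A' A pos] N
      by (simp only: t_normal_def)
  qed (use bA bA' pos in \<open>auto intro: block_circulant_mult\<close>)
  then show ?thesis by (simp add: normal_mat_def bcirc_t_adjoint[OF A pos])
qed

lemma sum_lessThan_mult_div_mod: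
  fixes g :: "nat \<Rightarrow> nat \<Rightarrow> 'a :: comm_monoid_add"
  assumes "0 < n"
  shows "(\<Sum>i<n * m. g (i div n) (i mod n)) = (\<Sum>k<m. \<Sum>r<n. g k r)"
proof -
  have lt: "k * n + r < m * n" if "k < m" "r < n" for k r
    using block_index_less[OF that] by (simp add: mult.commute)
  have "(\<Sum>i<n * m. g (i div n) (i mod n)) = (\<Sum>(k, r)\<in>{..<m} \<times> {..<n}. g k r)"
    by (rule sum.reindex_bij_witness[of _ "\<lambda>(k, r). k * n + r" "\<lambda>i. (i div n, i mod n)"])
      (use assms in \<open>auto simp: less_mult_imp_div_less mult.commute[of n] lt\<close>)
  then show ?thesis by (simp add: sum.cartesian_product)
qed

text \<open>Every entry of the tensor occurs once in each of the \<open>n3\<close> block columns.\<close>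

lemma mat_sq_norm_bcirc:
  assumes A: "A \<in> carrier_tensor n n n3" and pos: "0 < n" "0 < n3"
  shows "mat_sq_norm (bcirc A) = real n3 * (t_frob_norm A)\<^sup>2"
proof -
  note bA = block_circulantD[OF block_circulant_bcirc[OF A pos]]
  let ?N = "n * n3"
  define h where "h j = (\<Sum>i<?N. (cmod (bcirc A $$ (i, j)))\<^sup>2)" for j
  have shift: "h j = h (j mod n)" if j: "j < ?N" for j
  proof -
    let ?s = "block_shift n n3 (n3 - j div n)"
    have "h (j mod n) = (\<Sum>i<?N. (cmod (bcirc A $$ (?s i, ?s j)))\<^sup>2)"
      unfolding h_def block_shift_to_first_column[OF pos(1) j]
      by (rule sum.reindex_bij_betw[OF block_shift_bij[OF pos], symmetric])
    also have "\<dots> = h j" unfolding h_def using j by (intro sum.cong refl) (simp add: bA(2))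
    finally show ?thesis by simp
  qed
  have first: "h j = (\<Sum>k<n3. \<Sum>r<n. (cmod (A ! k $$ (r, j)))\<^sup>2)" if j: "j < n" for j
    unfolding h_def using sum_lessThan_mult_div_mod[OF pos(1), of "\<lambda>k r. (cmod (A ! k $$ (r, j)))\<^sup>2" n3]
    by (simp add: bcirc_first_column[OF A pos _ j])
  have "mat_sq_norm (bcirc A) = (\<Sum>j<?N. h j)" using bA(1) by (simp add: mat_sq_norm_def h_def)
  also have "\<dots> = (\<Sum>j<?N. h (j mod n))" by (intro sum.cong refl) (simp add: shift)
  also have "\<dots> = real n3 * (\<Sum>j<n. h j)"
    using sum_lessThan_mult_div_mod[OF pos(1), of "\<lambda>_. h" n3] by simp
  also have "(\<Sum>j<n. h j) = (\<Sum>j<n. \<Sum>k<n3. \<Sum>r<n. (cmod (A ! k $$ (r, j)))\<^sup>2)"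
    by (intro sum.cong refl) (simp add: first)
  also have "\<dots> = (\<Sum>k<n3. \<Sum>j<n. \<Sum>r<n. (cmod (A ! k $$ (r, j)))\<^sup>2)" by (rule sum.swap)
  also have "\<dots> = (\<Sum>k<n3. \<Sum>r<n. \<Sum>j<n. (cmod (A ! k $$ (r, j)))\<^sup>2)"
    by (intro sum.cong refl sum.swap)
  also have "\<dots> = (t_frob_norm A)\<^sup>2"
    using carrier_tensorD[OF A] by (simp add: t_frob_norm_def sum_nonneg)
  finally show ?thesis .
qed

lemma t_minus_carrier:
  assumes "A \<in> carrier_tensor n1 n2 n3" "B \<in> carrier_tensor n1 n2 n3"
  shows "B -\<^sub>t A \<in> carrier_tensor n1 n2 n3"
  using assms by (auto simp: t_minus_def carrier_tensor_def set_zip intro!: minus_carrier_mat)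

lemma bcirc_t_minus:
  fixes A B :: "'a :: group_add tensor"
  assumes A: "A \<in> carrier_tensor n n n3" and B: "B \<in> carrier_tensor n n n3" and pos: "0 < n" "0 < n3"
  shows "bcirc (B -\<^sub>t A) = bcirc B - bcirc A"
proof (rule eq_matI)
  note C = t_minus_carrier[OF A B]
  note c = bcirc_carrier[OF A pos(2)] bcirc_carrier[OF B pos(2)] bcirc_carrier[OF C pos(2)]
  fix i j assume "i < dim_row (bcirc B - bcirc A)" "j < dim_col (bcirc B - bcirc A)"
  then have ij: "i < n * n3" "j < n * n3" using c by auto
  have "nat ((int (i div n) - int (j div n)) mod int n3) < n3"
    using pos nat_less_iff[of "(int (i div n) - int (j div n)) mod int n3" n3] by simp
  then have "bcirc (B -\<^sub>t A) $$ (i, j) = bcirc B $$ (i, j) - bcirc A $$ (i, j)"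
    unfolding bcirc_index[OF A pos(2) ij] bcirc_index[OF B pos(2) ij] bcirc_index[OF C pos(2) ij]
    using pos carrier_tensorD[OF A] carrier_tensorD[OF B] by (simp add: t_minus_def)
  then show "bcirc (B -\<^sub>t A) $$ (i, j) = (bcirc B - bcirc A) $$ (i, j)" using ij c by simp
qed (use bcirc_carrier[OF A pos(2)] bcirc_carrier[OF t_minus_carrier[OF A B] pos(2)] in auto)

section \<open>Perturbation of the t-eigenvalues of normal tensors\<close>

text \<open>For a value that is not an eigenvalue both sides are zero.\<close>

lemma lists_t_eigenvalues_card:
  assumes A: "A \<in> carrier_tensor n n n3" and pos: "0 < n3"
    and L: "lists_t_eigenvalues A (n * n3) lam"
  shows "card {i \<in> {1..n * n3}. lam i = z} = Polynomial.order z (char_poly (bcirc A))"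
proof (cases "t_eigenvalue A z")
  case True
  then show ?thesis using L by (simp add: lists_t_eigenvalues_def t_multiplicity_def)
next
  case False
  then have "{i \<in> {1..n * n3}. lam i = z} = {}" using L by (auto simp: lists_t_eigenvalues_def)
  moreover have "poly (char_poly (bcirc A)) z \<noteq> 0"
    using False t_eigenvalue_iff_eigenvalue_bcirc[OF A pos]
      eigenvalue_root_char_poly[OF bcirc_carrier[OF A pos]] by simp
  ultimately show ?thesis by (simp add: order_0I)
qed

theorem theorem5p4:
  fixes A B :: "complex tensor" and n n3 :: nat and lam mu :: "nat \<Rightarrow> complex"
  assumes "0 < n" and "0 < n3"
    and "A \<in> carrier_tensor n n n3" and "B \<in> carrier_tensor n n n3"
    and "t_normal A" and "t_normal B"
    and "lists_t_eigenvalues A (n * n3) lam"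
    and "lists_t_eigenvalues B (n * n3) mu"
  shows "\<exists>p. p permutes {1..n * n3} \<and>
    sqrt (\<Sum>i = 1..n * n3. (cmod (mu (p i) - lam i))\<^sup>2) \<le> real n3 * t_frob_norm (B -\<^sub>t A)"
proof -
  note pos = assms(1,2) and A = assms(3) and B = assms(4)
  obtain p where p: "p permutes {1..n * n3}"
    "(\<Sum>i = 1..n * n3. (cmod (mu (p i) - lam i))\<^sup>2) \<le> mat_sq_norm (bcirc B - bcirc A)"
    using Hoffman_Wielandt[of "bcirc A" "n * n3" "bcirc B" "{1..n * n3}" lam mu]
      bcirc_carrier[OF A pos(2)] bcirc_carrier[OF B pos(2)]
      normal_mat_bcirc[OF A pos assms(5)] normal_mat_bcirc[OF B pos assms(6)]
      lists_t_eigenvalues_card[OF A pos(2) assms(7)] lists_t_eigenvalues_card[OF B pos(2) assms(8)]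
    by blast
  have frob0: "0 \<le> t_frob_norm (B -\<^sub>t A)" by (simp add: t_frob_norm_def sum_nonneg)
  note p(2)
  also have "mat_sq_norm (bcirc B - bcirc A) = real n3 * (t_frob_norm (B -\<^sub>t A))\<^sup>2"
    using mat_sq_norm_bcirc[OF t_minus_carrier[OF A B] pos] bcirc_t_minus[OF A B pos] by simp
  also have "\<dots> \<le> (real n3)\<^sup>2 * (t_frob_norm (B -\<^sub>t A))\<^sup>2"
    using pos by (intro mult_right_mono) (auto simp: power2_eq_square)
  also have "\<dots> = (real n3 * t_frob_norm (B -\<^sub>t A))\<^sup>2" by (simp add: power_mult_distrib)
  finally have "sqrt (\<Sum>i = 1..n * n3. (cmod (mu (p i) - lam i))\<^sup>2) \<le> real n3 * t_frob_norm (B -\<^sub>t A)"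
    using frob0 by (intro real_le_lsqrt) (auto simp: sum_nonneg)
  then show ?thesis using p(1) by blast
qed

end
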